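(* Let $K\subset\mathbb{R}$ be a fixed bounded interval. Let $\gamma$ be a curve in $\mathbb{S}^2$ that is $C^4$ on a neighborhood of $\{\theta h:\theta\in K\}$, and assume that all points appearing in the SIDER2 construction from $p_0,p_1,p_2$, $p_i=\gamma(ih)$, remain in a common geodesically convex ball of radius $O(h)$. Let $P_{012}$ be the SIDER2 interpolant of $p_0,p_1,p_2$. For $s=\theta h$, uniformly for $\theta\in K$, $$\operatorname{Log}_{\gamma(s)}P_{012}(s)=-\frac{h^3}{6}\,\theta(\theta-1)(\theta-2)\,B+O(h^4),$$ where $B=X^{(3)}(0)$ is the third derivative at $\eta=0$ of the normal-coordinate curve $X(\eta)=\operatorname{Log}_{\gamma(s)}\gamma(s+\eta)$. Consequently, on any fixed bounded interval of the normalized parameter $\theta$, $$d_{\mathbb{S}^2}\!\left(\gamma(s),P_{012}(s)\right)=O(h^3).$$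
   Context: $\mathbb{S}^2=\{x\in\mathbb{R}^3:|x|=1\}$ with the induced Riemannian metric; $d_{\mathbb{S}^2}(y,z)=\arccos(y\cdot z)$. $\operatorname{Exp}_y(v)=\cos|v|\,y+\frac{\sin|v|}{|v|}v$ for $v\in T_y\mathbb{S}^2=\{v\in\mathbb{R}^3:v\cdot y=0\}$ (with $\operatorname{Exp}_y(0)=y$). For $z$ not antipodal to $y$ and $\alpha=\arccos(y\cdot z)$, $\operatorname{Log}_y(z)=\frac{\alpha}{\sin\alpha}(z-(y\cdot z)y)$ (with $\operatorname{Log}_y(y)=0$). For non-antipodal $a,b\in\mathbb{S}^2$ and any real $\lambda$, $\operatorname{SLERP}(a,b,\lambda)=\operatorname{Exp}_a(\lambda\operatorname{Log}_a b)$, equivalently $\frac{\sin((1-\lambda)\alpha)}{\sin\alpha}a+\frac{\sin(\lambda\alpha)}{\sin\alpha}b$ with $\alpha=\arccos(a\cdot b)\in(0,\pi)$. SIDER2. With $d_a=\operatorname{SLERP}(p_2,p_1,2)$, $d_b=\operatorname{SLERP}(p_0,p_1,2)$ and $\tau=\frac{s}{2h}$, $$P_{012}(s)=\operatorname{SLERP}\bigl(\operatorname{SLERP}(p_0,d_a,\tau),\operatorname{SLERP}(d_b,p_2,\tau),\tau\bigr).$$ Conventions: $\gamma$ is a fixed curve and $h\to0^+$; $h$ is small enough that, in the common geodesically convex ball, logarithms are single-valued and geodesics unique. $O(h^m)$ means bounded in norm by $Ch^m$ for all sufficiently small $h$, with $C$ independent of $h$ and of $\theta$ in the bounded interval.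
   Formalization: The curve is assumed C^4 on a fixed open set containing the parameter 0 (hence, for small h, all nodes and all θh); when K does not contain 0, C^4 near {θh : θ in K} alone is not enough and the claim can fail. *)

theory Defs
  imports "HOL-Analysis.Analysis" "HOL-Library.Landau_Symbols"
begin

abbreviation S2 :: "(real ^ 3) set" where
  "S2 \<equiv> sphere 0 1"

definition dist_S2 :: "real ^ 3 \<Rightarrow> real ^ 3 \<Rightarrow> real" where
  "dist_S2 y z = arccos (y \<bullet> z)"

(* Meaningful for y in S2 and v in the tangent space, i.e. v orthogonal to y. *)
definition Exp_S2 :: "real ^ 3 \<Rightarrow> real ^ 3 \<Rightarrow> real ^ 3" where
  "Exp_S2 y v =
     (if v = 0 then y else cos (norm v) *\<^sub>R y + (sin (norm v) / norm v) *\<^sub>R v)"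

(* Meaningful for y, z in S2 with z not antipodal to y; for z = - y the value is a
   convention without geometric content. *)
definition Log_S2 :: "real ^ 3 \<Rightarrow> real ^ 3 \<Rightarrow> real ^ 3" where
  "Log_S2 y z =
     (if z = y then 0
      else (arccos (y \<bullet> z) / sin (arccos (y \<bullet> z))) *\<^sub>R (z - (y \<bullet> z) *\<^sub>R y))"

definition slerp :: "real ^ 3 \<Rightarrow> real ^ 3 \<Rightarrow> real \<Rightarrow> real ^ 3" where
  "slerp a b t = Exp_S2 a (t *\<^sub>R Log_S2 a b)"

(* The nodes p0, p1, p2 sit at parameters 0, h, 2 h; s / (2 * h) normalizes [0, 2 h] to
   [0, 1], and is also used outside [0, 1] for extrapolation. *)
definition sider2_da :: "real ^ 3 \<Rightarrow> real ^ 3 \<Rightarrow> real ^ 3" where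
  "sider2_da p1 p2 = slerp p2 p1 2"

definition sider2_db :: "real ^ 3 \<Rightarrow> real ^ 3 \<Rightarrow> real ^ 3" where
  "sider2_db p0 p1 = slerp p0 p1 2"

definition sider2_left ::
    "real \<Rightarrow> real ^ 3 \<Rightarrow> real ^ 3 \<Rightarrow> real ^ 3 \<Rightarrow> real \<Rightarrow> real ^ 3" where
  "sider2_left h p0 p1 p2 s = slerp p0 (sider2_da p1 p2) (s / (2 * h))"

definition sider2_right ::
    "real \<Rightarrow> real ^ 3 \<Rightarrow> real ^ 3 \<Rightarrow> real ^ 3 \<Rightarrow> real \<Rightarrow> real ^ 3" where
  "sider2_right h p0 p1 p2 s = slerp (sider2_db p0 p1) p2 (s / (2 * h))"

definition sider2 ::
    "real \<Rightarrow> real ^ 3 \<Rightarrow> real ^ 3 \<Rightarrow> real ^ 3 \<Rightarrow> real \<Rightarrow> real ^ 3" where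
  "sider2 h p0 p1 p2 s =
     slerp (sider2_left h p0 p1 p2 s) (sider2_right h p0 p1 p2 s) (s / (2 * h))"

definition sider2_points ::
    "real \<Rightarrow> real ^ 3 \<Rightarrow> real ^ 3 \<Rightarrow> real ^ 3 \<Rightarrow> real \<Rightarrow> (real ^ 3) set" where
  "sider2_points h p0 p1 p2 s =
     {p0, p1, p2, sider2_da p1 p2, sider2_db p0 p1,
      sider2_left h p0 p1 p2 s, sider2_right h p0 p1 p2 s, sider2 h p0 p1 p2 s}"

definition ball_S2 :: "real ^ 3 \<Rightarrow> real \<Rightarrow> (real ^ 3) set" where
  "ball_S2 c r = {z \<in> S2. dist_S2 c z < r}"

(* Two points of S2 are joined by a unique minimizing geodesic iff they are not antipodal,
   and that geodesic is then slerp a b on [0, 1]. *)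
definition geodesically_convex :: "(real ^ 3) set \<Rightarrow> bool" where
  "geodesically_convex A \<longleftrightarrow>
     A \<subseteq> S2 \<and> (\<forall>a\<in>A. \<forall>b\<in>A. a \<noteq> - b \<and> (\<forall>t\<in>{0..1}. slerp a b t \<in> A))"

definition nth_vector_derivative ::
    "nat \<Rightarrow> (real \<Rightarrow> 'a::real_normed_vector) \<Rightarrow> real \<Rightarrow> 'a" where
  "nth_vector_derivative n = (\<lambda>f t. vector_derivative f (at t)) ^^ n"

(* Intended for open U, since the derivatives are two-sided. *)
definition Ck_on :: "nat \<Rightarrow> (real \<Rightarrow> 'a::real_normed_vector) \<Rightarrow> real set \<Rightarrow> bool" where
  "Ck_on k f U \<longleftrightarrow>
     (\<forall>j<k. \<forall>t\<in>U. nth_vector_derivative j f differentiable at t) \<and>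
     continuous_on U (nth_vector_derivative k f)"

definition normal_curve :: "(real \<Rightarrow> real ^ 3) \<Rightarrow> real \<Rightarrow> real \<Rightarrow> real ^ 3" where
  "normal_curve \<gamma> s \<eta> = Log_S2 (\<gamma> s) (\<gamma> (s + \<eta>))"

end

theory Submission
  imports Defs
begin

text \<open>
  Everything is expanded in \<open>h\<close> with remainders \<open>O(h\<^sup>4)\<close> uniform in \<open>\<theta>\<close>. For unit vectors \<open>a\<close>, \<open>b\<close>
  with \<open>x = |b - a|\<^sup>2\<close>,
  \<open>slerp a b t = a + (t + t (1 - t\<^sup>2) x / 6) (b - a) + (t (1 - t) x / 2) a + O(x\<^sup>2)\<close>,
  so slerp acts on third-order jets of families of points on the sphere by polynomial formulas.
  Composing these along the SIDER2 construction gives the jet of the interpolant, which differs from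
  the Taylor polynomial of \<open>\<gamma>(\<theta> h)\<close> by \<open>- h\<^sup>3 \<theta> (\<theta> - 1) (\<theta> - 2) B / 6\<close> with
  \<open>B = |D\<gamma>|\<^sup>2 D\<gamma> + D\<^sup>3\<gamma> + 3 (D\<gamma> \<bullet> D\<^sup>2\<gamma>) \<gamma>\<close>. Since \<open>Log\<^sub>y z = z - y + O(|z - y|\<^sup>2)\<close>, it remains to identify
  \<open>B\<close> with the third derivative of the normal-coordinate curve. For this,
  \<open>Log\<^sub>y z = g(1 - y \<bullet> z) (z - (y \<bullet> z) y)\<close>, where \<open>g\<close> is a power series around \<open>0\<close> with
  \<open>g(0) = 1\<close> and \<open>g'(0) = 1/3\<close>, so the curve can be differentiated at its base point as well.
\<close>

section \<open>The logarithm near its base point\<close>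

text \<open>Taylor coefficients at u = 0 of arccos c / sqrt (1 - c^2) in the variable u = 1 - c. The
  recursion is what comparing coefficients in the equation of \<open>logser_ode\<close>
  yields.\<close>

fun logc :: "nat \<Rightarrow> real" where
  "logc 0 = 1"
| "logc (Suc n) = (real n + 1) / (2 * real n + 3) * logc n"

text \<open>The k-th derivative of the series, by termwise differentiation. The quotient arccos c /
  sin (arccos c) degenerates to 0 / 0 at c = 1, whereas the series is smooth there.\<close>

definition logser :: "nat \<Rightarrow> real \<Rightarrow> real" where
  "logser k u = (\<Sum>n. (diffs ^^ k) logc n * u ^ n)"

lemma logc_bounds: "0 < logc n \<and> logc n \<le> 1"
proof (induction n)
  case (Suc n)
  have "(real n + 1) / (2 * real n + 3) \<le> 1" "(real n + 1) / (2 * real n + 3) > 0" by simp_all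
  then have "(real n + 1) / (2 * real n + 3) * logc n \<le> 1" using Suc by (intro mult_le_one) auto
  then show ?case using Suc by simp
qed simp

lemma summable_diffs_logc: "\<bar>u\<bar> < 1 \<Longrightarrow> summable (\<lambda>n. (diffs ^^ k) logc n * u ^ n)"
proof (induction k arbitrary: u)
  case 0
  have "summable (\<lambda>n. \<bar>u\<bar> ^ n)" using 0 by (simp add: summable_geometric)
  then show ?case
    by (rule summable_comparison_test') (simp add: abs_mult power_abs logc_bounds less_imp_le mult_left_le_one_le)
next
  case (Suc k)
  then show ?case using termdiff_converges[of u 1 "(diffs ^^ k) logc"] by simp
qed

lemma logser_has_derivative:
  assumes "\<bar>u\<bar> < 1"
  shows "(logser k has_field_derivative logser (Suc k) u) (at u)"
proof -
  obtain r where r: "\<bar>u\<bar> < r" "r < 1" using assms dense by blast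
  then have "summable (\<lambda>n. (diffs ^^ k) logc n * r ^ n)" by (intro summable_diffs_logc) auto
  then have "((\<lambda>x. \<Sum>n. (diffs ^^ k) logc n * x ^ n) has_field_derivative
     (\<Sum>n. diffs ((diffs ^^ k) logc) n * u ^ n)) (at u)"
    by (rule termdiffs_strong) (use r in auto)
  then show ?thesis unfolding logser_def[abs_def] by simp
qed

lemma logser_at_0: "logser 0 0 = 1" "logser 1 0 = 1 / 3"
  using powser_zero[of "diffs logc"] unfolding logser_def
  by (simp_all add: powser_zero) (simp add: diffs_def)

text \<open>This is the equation \<open>(1 - c\<^sup>2) g' = c g - 1\<close> for \<open>g = arccos c / sin (arccos c)\<close>, written in \<open>u = 1 - c\<close>.\<close>
lemma logser_ode:
  assumes "\<bar>u\<bar> < 1"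
  shows "(2 * u - u\<^sup>2) * logser 1 u + (1 - u) * logser 0 u = 1"
proof -
  \<comment> \<open>Chosen to telescope: by the recursion for \<open>logc\<close>, the n-th term of
    the left-hand side equals \<open>S n - S (Suc n)\<close>. Since \<open>S 0 = 1\<close> and
    \<open>S\<close> tends to 0, the sum is 1.\<close>
  define S where "S = (\<lambda>n. logc n * u ^ n + real n * logc n * u ^ Suc n)"
  have s0: "(\<lambda>n. logc n * u ^ n) sums logser 0 u"
    using summable_diffs_logc[OF assms, of 0] unfolding logser_def by (simp add: summable_sums)
  have s1: "(\<lambda>n. real (Suc n) * logc (Suc n) * u ^ n) sums logser 1 u"
    using summable_diffs_logc[OF assms, of 1] summable_sums unfolding logser_def diffs_def by fastforce
  have l0: "(\<lambda>n. logc n * u ^ n) \<longlonglongrightarrow> 0"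
    using s0 summable_LIMSEQ_zero sums_summable by blast
  have "(\<lambda>n. real (Suc n) * logc (Suc n) * u ^ n) \<longlonglongrightarrow> 0"
    using s1 summable_LIMSEQ_zero sums_summable by blast
  \<comment> \<open>Times u^2, the terms of the convergent derivative series are the second summand
    of \<open>S\<close> shifted by one index.\<close>
  then have "(\<lambda>n. real (Suc n) * logc (Suc n) * u ^ n * u\<^sup>2) \<longlonglongrightarrow> 0 * u\<^sup>2"
    by (intro tendsto_mult) auto
  then have "(\<lambda>n. real (Suc n) * logc (Suc n) * u ^ Suc (Suc n)) \<longlonglongrightarrow> 0"
    by (simp only: power_Suc power2_eq_square mult_ac mult_zero_left)
  then have "(\<lambda>n. real n * logc n * u ^ Suc n) \<longlonglongrightarrow> 0"
    using filterlim_sequentially_Suc[where f = "\<lambda>n. real n * logc n * u ^ Suc n"] by blast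
  with l0 have "S \<longlonglongrightarrow> 0" unfolding S_def using tendsto_add by fastforce
  then have "(\<lambda>n. S n - S (Suc n)) sums (S 0 - 0)"
    by (rule telescope_sums')
  moreover have "S n - S (Suc n) =
      (2 * u - u\<^sup>2) * (real (Suc n) * logc (Suc n) * u ^ n) + (1 - u) * (logc n * u ^ n)" for n
  proof -
    have "(2 * real n + 3) * logc (Suc n) = (real n + 1) * logc n" by simp
    then have "u ^ Suc n * ((2 * real n + 3) * logc (Suc n)) = u ^ Suc n * ((real n + 1) * logc n)"
      by simp
    then show ?thesis unfolding S_def
      by (simp del: logc.simps add: algebra_simps power2_eq_square)
  qed
  moreover have "(\<lambda>n. (2 * u - u\<^sup>2) * (real (Suc n) * logc (Suc n) * u ^ n) + (1 - u) * (logc n * u ^ n))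
      sums ((2 * u - u\<^sup>2) * logser 1 u + (1 - u) * logser 0 u)"
    by (intro sums_add sums_mult s0 s1)
  ultimately show ?thesis
    using sums_unique2 by (fastforce simp: S_def)
qed

text \<open>The difference of the two sides vanishes at 0, and its derivative is zero by
  \<open>logser_ode\<close> at u = 1 - cos y, where 2 u - u^2 = sin^2 y and 1 - u = cos y. Below pi
  / 2 the argument stays inside the disc of convergence.\<close>

lemma logser_one_minus_cos:
  assumes "0 \<le> x" "x < pi / 2"
  shows "logser 0 (1 - cos x) * sin x = x"
proof -
  define f where "f = (\<lambda>y. logser 0 (1 - cos y) * sin y - y)"
  have "(f has_field_derivative 0) (at y)" if "0 \<le> y" "y \<le> x" for y
  proof -
    have "0 < cos y" using that assms by (intro cos_gt_zero_pi) auto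
    then have u: "\<bar>1 - cos y\<bar> < 1" using cos_le_one[of y] by auto
    have "(f has_field_derivative logser 1 (1 - cos y) * sin y * sin y + cos y * logser 0 (1 - cos y) - 1) (at y)"
      unfolding f_def
      by (rule derivative_eq_intros
            DERIV_chain2[where f = "logser 0" and g = "\<lambda>y. 1 - cos y", OF logser_has_derivative[OF u]] refl | simp)+
    moreover have "2 * (1 - cos y) - (1 - cos y)\<^sup>2 = sin y * sin y"
      using sin_cos_squared_add[of y] by (simp add: power2_eq_square algebra_simps)
    moreover from this have "sin y * sin y * logser 1 (1 - cos y) + cos y * logser 0 (1 - cos y) = 1"
      using logser_ode[OF u] by simp
    ultimately show ?thesis by (simp add: mult_ac)
  qed
  note deriv = this
  have "continuous_on {0..x} f"
    by (intro continuous_at_imp_continuous_on ballI DERIV_isCont[OF deriv]) auto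
  then have "f x = f 0"
    using assms(1) deriv DERIV_isconst2[of 0 x f x] by (cases "x = 0") auto
  then show ?thesis by (simp add: f_def)
qed

lemma norm_one_inner_bounds:
  fixes a b :: "'a::real_inner"
  assumes "norm a = 1" "norm b = 1"
  shows "\<bar>a \<bullet> b\<bar> \<le> 1"
  using Cauchy_Schwarz_ineq2[of a b] assms by simp

lemma inner_eq_norm_diff:
  fixes a b :: "'a::real_inner"
  assumes "norm a = 1" "norm b = 1"
  shows "a \<bullet> b = 1 - (norm (b - a))\<^sup>2 / 2"
  using assms by (simp add: norm_eq_1 power2_norm_eq_inner inner_commute field_simps inner_diff_left inner_diff_right)

text \<open>The condition on the inner product puts the angle below pi / 2. The resulting formula is
  uniform across z = y, which makes the logarithm differentiable along a curve through its base
  point.\<close>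

lemma Log_S2_eq_logser:
  assumes "norm y = 1" "norm z = 1" "y \<bullet> z > 0"
  shows "Log_S2 y z = logser 0 (1 - y \<bullet> z) *\<^sub>R (z - (y \<bullet> z) *\<^sub>R y)"
proof (cases "z = y")
  case True
  then show ?thesis using assms by (simp add: Log_S2_def norm_eq_1)
next
  case False
  define x where "x = arccos (y \<bullet> z)"
  have c: "\<bar>y \<bullet> z\<bar> \<le> 1" "y \<bullet> z < 1"
    using norm_one_inner_bounds inner_eq_norm_diff[of y z] assms False by auto
  then have x: "cos x = y \<bullet> z" "0 \<le> x" "x \<le> pi"
    unfolding x_def by (auto intro!: cos_arccos_abs arccos_lbound arccos_ubound)
  then have "x < pi / 2" using assms(3) cos_monotone_0_pi_le[of "pi/2" x] by (force simp: not_less)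
  moreover have "x \<noteq> 0" using x c by auto
  ultimately have "sin x > 0" using x by (intro sin_gt_zero) auto
  then have "x / sin x = logser 0 (1 - cos x)"
    using logser_one_minus_cos[of x] x \<open>x < pi/2\<close> by (simp add: field_simps)
  then show ?thesis using False unfolding Log_S2_def x_def[symmetric] by (simp add: x)
qed

section \<open>Local expansions on the sphere\<close>

lemma sin_cubic_bound: "\<bar>sin x - (x - x ^ 3 / 6)\<bar> \<le> \<bar>x\<bar> ^ 5 / 120" for x :: real
proof -
  have "{..<5::nat} = {0, 1, 2, 3, 4}" by auto
  then have "(\<Sum>m<5. sin_coeff m * x ^ m) = x - x ^ 3 / 6"
    by (simp add: sin_coeff_def fact_numeral)
  then show ?thesis
    using Maclaurin_sin_bound[of x 5] by (simp add: fact_numeral)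
qed

lemma cos_quadratic_bound: "\<bar>cos x - (1 - x ^ 2 / 2)\<bar> \<le> x ^ 4 / 24" for x :: real
proof -
  obtain t where t: "cos x = (\<Sum>m<4. cos_coeff m * x ^ m) + (cos (t + 1/2 * real 4 * pi) / fact 4) * x ^ 4"
    using Maclaurin_cos_expansion[of x 4] by blast
  have "(\<Sum>m<4. cos_coeff m * x ^ m) = 1 - x ^ 2 / 2"
  proof -
    have "{..<4::nat} = {0, 1, 2, 3}" by auto
    then show ?thesis by (simp add: cos_coeff_def fact_numeral)
  qed
  with t have "\<bar>cos x - (1 - x ^ 2 / 2)\<bar> = \<bar>cos (t + 1/2 * real 4 * pi)\<bar> * (x ^ 4 / 24)"
    by (simp add: abs_mult fact_numeral)
  also have "\<dots> \<le> 1 * (x ^ 4 / 24)"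
    by (intro mult_right_mono) auto
  finally show ?thesis by simp
qed

lemma half_le_sin:
  fixes x :: real
  assumes "0 \<le> x" "x \<le> 1"
  shows "x / 2 \<le> sin x"
proof -
  have "x ^ 3 \<le> x" "x ^ 5 \<le> x"
    using assms power_decreasing[of 1 3 x] power_decreasing[of 1 5 x] by auto
  then show ?thesis using sin_cubic_bound[of x] assms by (simp add: abs_if split: if_splits)
qed

section \<open>Angle, logarithm and distance of nearby points\<close>

text \<open>A bootstrap on 1 - cos \<alpha> = \<delta>^2 / 2: monotonicity of cosine gives \<alpha>
  \<le> 1, the quartic cosine error is then absorbed to give \<alpha>^2 \<le> 2 \<delta>^2, and
  reinserting this turns the error into a multiple of \<delta>^4.\<close>

lemma angle_of_close_unit_vectors:
  fixes a b :: "'a::real_inner"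
  assumes "norm a = 1" "norm b = 1" "norm (b - a) \<le> 1 / 2"
  defines "\<alpha> \<equiv> arccos (a \<bullet> b)" and "\<delta> \<equiv> norm (b - a)"
  shows "cos \<alpha> = a \<bullet> b" "0 \<le> \<alpha>" "\<alpha> \<le> 1" "\<alpha>\<^sup>2 \<le> 2 * \<delta>\<^sup>2" "\<bar>\<alpha>\<^sup>2 - \<delta>\<^sup>2\<bar> \<le> \<delta>^4"
proof -
  have d: "a \<bullet> b = 1 - \<delta>\<^sup>2 / 2" using inner_eq_norm_diff[OF assms(1,2)] by (simp add: \<delta>_def)
  have b: "\<bar>a \<bullet> b\<bar> \<le> 1" using norm_one_inner_bounds assms by auto
  show c: "cos \<alpha> = a \<bullet> b" unfolding \<alpha>_def using b by (rule cos_arccos_abs)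
  show p: "0 \<le> \<alpha>" unfolding \<alpha>_def using b by (auto intro: arccos_lbound)
  have pi: "\<alpha> \<le> pi" unfolding \<alpha>_def using b by (auto intro: arccos_ubound)
  have "\<delta>\<^sup>2 \<le> (1/2)\<^sup>2" unfolding \<delta>_def using assms by (intro power_mono) auto
  \<comment> \<open>Here 13/24 = 1 - 1/2 + 1/24, which lies below 7/8, a lower bound of cos
    \<alpha>.\<close>
  moreover have "cos (1::real) \<le> 13 / 24" using cos_quadratic_bound[of 1] by (auto simp: abs_if split: if_splits)
  ultimately have "cos 1 \<le> cos \<alpha>" using c d by (simp add: power2_eq_square)
  then show one: "\<alpha> \<le> 1" using pi p cos_mono_le_eq[of 1 \<alpha>] pi_ge_two by auto
  have q: "\<bar>\<alpha>\<^sup>2 - \<delta>\<^sup>2\<bar> \<le> \<alpha> ^ 4 / 12" using cos_quadratic_bound[of \<alpha>] c d by (simp add: abs_if split: if_splits)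
  have "\<alpha> ^ 4 \<le> \<alpha>\<^sup>2" using p one by (intro power_decreasing) auto
  with q show r: "\<alpha>\<^sup>2 \<le> 2 * \<delta>\<^sup>2" by (simp add: abs_if split: if_splits)
  have "\<alpha> ^ 4 \<le> 4 * \<delta> ^ 4" using power_mono[OF r, of 2] by (simp add: power_mult_distrib flip: power_mult)
  moreover have "0 \<le> \<delta> ^ 4" by simp
  ultimately show "\<bar>\<alpha>\<^sup>2 - \<delta>\<^sup>2\<bar> \<le> \<delta>^4"
    using q by linarith
qed

text \<open>The scalar factor \<alpha> / sin \<alpha> is 1 up to \<delta>^2, and projecting the
  chord to the tangent plane changes it by a normal vector of length \<delta>^2 / 2. For a chord of
  size O(h^3) the error is therefore O(h^6).\<close>

lemma Log_S2_close:
  fixes y z :: "real ^ 3"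
  assumes "norm y = 1" "norm z = 1" "norm (z - y) \<le> 1 / 2"
  shows "norm (Log_S2 y z - (z - y)) \<le> 2 * (norm (z - y))\<^sup>2"
proof (cases "z = y")
  case True
  then show ?thesis by (simp add: Log_S2_def)
next
  case False
  define \<alpha> \<delta> where "\<alpha> = arccos (y \<bullet> z)" and "\<delta> = norm (z - y)"
  note a = angle_of_close_unit_vectors[OF assms, folded \<alpha>_def \<delta>_def]
  have c: "y \<bullet> z = 1 - \<delta>\<^sup>2 / 2" using inner_eq_norm_diff[OF assms(1,2)] by (simp add: \<delta>_def)
  have d: "\<delta> > 0" "\<delta> \<le> 1 / 2" using False assms by (auto simp: \<delta>_def)
  have "\<alpha> \<noteq> 0" using a c d by auto
  then have al: "\<alpha> > 0" using a by simp
  have s: "\<alpha> / 2 \<le> sin \<alpha>" using half_le_sin a by simp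
  then have s0: "sin \<alpha> > 0" using al by simp
  define g where "g = \<alpha> / sin \<alpha>"
  have "\<alpha> ^ 5 \<le> \<alpha> ^ 3" using power_decreasing[of 3 5 \<alpha>] al a by auto
  then have "\<bar>\<alpha> - sin \<alpha>\<bar> \<le> \<alpha> ^ 3 / 5"
    using sin_cubic_bound[of \<alpha>] al zero_less_power[OF al, of 3] by (simp add: abs_if split: if_splits)
  also have "\<dots> \<le> (\<alpha>\<^sup>2 / 2) * (\<alpha> / 2)" using al by (simp add: eval_nat_numeral)
  also have "\<dots> \<le> (\<alpha>\<^sup>2 / 2) * sin \<alpha>" using s by (intro mult_left_mono) auto
  also have "\<dots> \<le> \<delta>\<^sup>2 * sin \<alpha>" using a s0 by (intro mult_right_mono) auto
  finally have "\<bar>\<alpha> - sin \<alpha>\<bar> / sin \<alpha> \<le> \<delta>\<^sup>2" using s0 by (simp add: field_simps)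
  moreover have "\<bar>\<alpha> - sin \<alpha>\<bar> / sin \<alpha> = \<bar>g - 1\<bar>" unfolding g_def using s0 by (simp add: abs_div_pos diff_divide_distrib)
  ultimately have g: "\<bar>g - 1\<bar> \<le> \<delta>\<^sup>2" by simp
  have d2: "\<delta>\<^sup>2 \<le> 1 / 4" "\<delta> ^ 3 \<le> \<delta>\<^sup>2 / 2"
    using d power_mono[of \<delta> "1/2" 2] by (auto simp: eval_nat_numeral)
  then have g2: "\<bar>g\<bar> \<le> 2" using g by auto
  \<comment> \<open>The projection of z is (z - y) + (\<delta>^2 / 2) y, because y . z = 1 -
    \<delta>^2 / 2.\<close>
  have "Log_S2 y z - (z - y) = (g - 1) *\<^sub>R (z - y) + (g * (\<delta>\<^sup>2 / 2)) *\<^sub>R y"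
    using False unfolding Log_S2_def \<alpha>_def[symmetric] g_def[symmetric]
    by (simp add: c algebra_simps scaleR_left.add)
  also have "norm \<dots> \<le> \<bar>g - 1\<bar> * \<delta> + \<bar>g\<bar> * (\<delta>\<^sup>2 / 2)"
    using assms d by (intro order_trans[OF norm_triangle_ineq]) (auto simp: \<delta>_def abs_mult)
  also have "\<dots> \<le> \<delta>\<^sup>2 * \<delta> + 2 * (\<delta>\<^sup>2 / 2)"
    using g g2 d by (intro add_mono mult_right_mono) auto
  also have "\<dots> = \<delta> ^ 3 + \<delta>\<^sup>2" by (simp add: eval_nat_numeral)
  also have "\<dots> \<le> 2 * \<delta>\<^sup>2" using d2(2) zero_le_power2[of \<delta>] by linarith
  finally show ?thesis by (simp add: \<delta>_def)
qed

lemma dist_S2_le: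
  assumes "norm y = 1" "norm z = 1" "norm (z - y) \<le> 1 / 2"
  shows "dist_S2 y z \<le> 2 * norm (z - y)"
proof -
  note a = angle_of_close_unit_vectors[OF assms]
  have "(dist_S2 y z)\<^sup>2 \<le> 2 * (norm (z - y))\<^sup>2" using a unfolding dist_S2_def by simp
  also have "\<dots> \<le> (2 * norm (z - y))\<^sup>2" by (simp add: power_mult_distrib)
  finally show ?thesis by (rule power2_le_imp_le) simp
qed

section \<open>Expansion of geodesic interpolation\<close>

lemma Log_S2_orthogonal: "norm a = 1 \<Longrightarrow> a \<bullet> Log_S2 a b = 0"
  by (auto simp: Log_S2_def inner_diff_right norm_eq_1)

lemma norm_slerp:
  assumes "norm a = 1"
  shows "norm (slerp a b t) = 1"
proof (cases "t *\<^sub>R Log_S2 a b = 0")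
  case False
  define v where "v = t *\<^sub>R Log_S2 a b"
  have o: "a \<bullet> v = 0" "v \<noteq> 0" using False Log_S2_orthogonal[OF assms, of b] unfolding v_def by auto
  have "(norm (slerp a b t))\<^sup>2 = (cos (norm v))\<^sup>2 + (sin (norm v) / norm v)\<^sup>2 * (norm v)\<^sup>2"
    using o assms unfolding slerp_def Exp_S2_def v_def[symmetric]
    by (simp add: power2_norm_eq_inner inner_add_left inner_add_right inner_commute norm_eq_1)
       (simp add: power2_eq_square)
  also have "\<dots> = 1" using o by (simp add: power_divide)
  finally show ?thesis by (simp add: power2_eq_1_iff) (metis norm_ge_zero not_one_le_zero neg_0_le_iff_le)
qed (use assms in \<open>simp add: slerp_def Exp_S2_def\<close>)

text \<open>The component of b orthogonal to a has length sin \<alpha>, so the logarithm has length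
  \<alpha>. For negative t the norm is - t \<alpha>, but cosine and sin x / x are even, so one
  formula covers all real t.\<close>

lemma slerp_formula:
  assumes "norm a = 1" "norm b = 1" "0 < \<alpha>" "\<alpha> < pi" "cos \<alpha> = a \<bullet> b"
  shows "slerp a b t = cos (t * \<alpha>) *\<^sub>R a + (sin (t * \<alpha>) / sin \<alpha>) *\<^sub>R (b - (a \<bullet> b) *\<^sub>R a)"
proof -
  have ac: "arccos (a \<bullet> b) = \<alpha>" using assms arccos_cos[of \<alpha>] by simp
  have s: "sin \<alpha> > 0" using assms by (intro sin_gt_zero) auto
  have ne: "b \<noteq> a" using ac assms by (auto simp: norm_eq_1)
  define w where "w = b - (a \<bullet> b) *\<^sub>R a"
  have "(norm w)\<^sup>2 = 1 - (cos \<alpha>)\<^sup>2"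
    using assms(1,2) unfolding assms(5) w_def
    by (simp add: power2_norm_eq_inner inner_diff_left inner_diff_right inner_commute norm_eq_1)
       (simp add: power2_eq_square)
  also have "\<dots> = (sin \<alpha>)\<^sup>2" by (simp add: sin_squared_eq)
  finally have w: "norm w = sin \<alpha>" using s by simp
  have L: "Log_S2 a b = (\<alpha> / sin \<alpha>) *\<^sub>R w" using ne by (simp add: Log_S2_def ac w_def)
  have nL: "norm (t *\<^sub>R Log_S2 a b) = \<bar>t * \<alpha>\<bar>" using s assms(3) by (simp add: L w abs_mult)
  show ?thesis
  proof (cases "t = 0")
    case True
    then show ?thesis by (simp add: slerp_def Exp_S2_def)
  next
    case False
    then have "t *\<^sub>R Log_S2 a b \<noteq> 0" using nL assms(3) by auto
    then show ?thesis unfolding w_def[symmetric]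
      using False assms(3) s unfolding slerp_def Exp_S2_def nL
      by (simp add: L abs_if)
  qed
qed

lemma abs_power_le_power:
  fixes t M :: real
  assumes "\<bar>t\<bar> \<le> M" "1 \<le> M" "k \<le> n"
  shows "\<bar>t\<bar> ^ k \<le> M ^ n"
  using power_mono[OF assms(1), of k] power_increasing[OF assms(3,2)] by simp

text \<open>Multiplying the claimed polynomial by sin \<alpha> reproduces sin (t \<alpha>) up to
  terms of order \<alpha>^5; dividing by sin \<alpha> \<ge> \<alpha> / 2 costs one order. As M \<ge>
  1, M^5 dominates all lower powers of t.\<close>

lemma sin_ratio_bound:
  fixes t \<alpha> :: real
  assumes "0 < \<alpha>" "\<alpha> \<le> 1" "\<bar>t\<bar> \<le> M" "1 \<le> M"
  shows "\<bar>sin (t * \<alpha>) / sin \<alpha> - (t + t * (1 - t\<^sup>2) / 6 * \<alpha>\<^sup>2)\<bar> \<le> M ^ 5 * \<alpha> ^ 4"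
proof -
  define R where "R = (\<lambda>x::real. sin x - (x - x ^ 3 / 6))"
  define N where "N = M ^ 5"
  define p where "p = t + t * (1 - t\<^sup>2) / 6 * \<alpha>\<^sup>2"
  have t: "\<bar>t\<bar> ^ 5 \<le> N" "\<bar>t\<bar> ^ 3 \<le> N" "\<bar>t\<bar> \<le> N" "1 \<le> N"
    using abs_power_le_power[OF assms(3,4), of 5 5] abs_power_le_power[OF assms(3,4), of 3 5]
      abs_power_le_power[OF assms(3,4), of 1 5] abs_power_le_power[OF assms(3,4), of 0 5]
    unfolding N_def by auto
  have s: "\<alpha> / 2 \<le> sin \<alpha>" using half_le_sin assms by simp
  have s0: "sin \<alpha> > 0" using s assms by simp
  have R1: "\<bar>R (t * \<alpha>)\<bar> \<le> N * \<alpha> ^ 5 / 120"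
  proof -
    have "\<bar>R (t * \<alpha>)\<bar> \<le> \<bar>t\<bar> ^ 5 * \<alpha> ^ 5 / 120"
      using sin_cubic_bound[of "t * \<alpha>"] assms unfolding R_def by (simp add: abs_mult power_mult_distrib)
    also have "\<dots> \<le> N * \<alpha> ^ 5 / 120" using t assms by (intro divide_right_mono mult_right_mono) auto
    finally show ?thesis .
  qed
  have R2: "\<bar>R \<alpha>\<bar> \<le> \<alpha> ^ 5 / 120" using sin_cubic_bound[of \<alpha>] assms unfolding R_def by simp
  have q: "\<bar>t * (1 - t\<^sup>2)\<bar> \<le> 2 * N"
  proof -
    have "t * (1 - t\<^sup>2) = t - t ^ 3" by (simp add: algebra_simps eval_nat_numeral)
    then show ?thesis using t abs_triangle_ineq4[of t "t ^ 3"] by (simp add: power_abs)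
  qed
  have a1: "\<alpha>\<^sup>2 \<le> 1" using assms by (simp add: power_le_one)
  have "\<bar>t * (1 - t\<^sup>2) / 6 * \<alpha>\<^sup>2\<bar> = \<bar>t * (1 - t\<^sup>2)\<bar> / 6 * \<alpha>\<^sup>2" by (simp add: abs_mult)
  also have "\<dots> \<le> 2 * N / 6 * 1" using q a1 t by (intro mult_mono divide_right_mono) auto
  finally have p: "\<bar>p\<bar> \<le> 2 * N" using t unfolding p_def by linarith
  \<comment> \<open>The coefficient of \<alpha>^2 in \<open>p\<close> is the one that cancels the
    cubic terms on both sides.\<close>
  have "sin (t * \<alpha>) - p * sin \<alpha> = R (t * \<alpha>) - p * R \<alpha> + t * (1 - t\<^sup>2) * \<alpha> ^ 5 / 36"
    unfolding R_def p_def by (simp add: field_simps) (simp add: algebra_simps eval_nat_numeral)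
  moreover have "\<bar>p * R \<alpha>\<bar> \<le> 2 * N * (\<alpha> ^ 5 / 120)"
    unfolding abs_mult using p R2 by (intro mult_mono) (use t in auto)
  moreover have "\<bar>t * (1 - t\<^sup>2) * \<alpha> ^ 5 / 36\<bar> \<le> 2 * N * \<alpha> ^ 5 / 36"
    using q assms by (simp add: abs_mult divide_right_mono mult_right_mono)
  moreover have "N * \<alpha> ^ 5 \<ge> 0" using t assms by simp
  \<comment> \<open>The constant 1/2 is generous: it splits off the factor \<alpha> / 2, which sin
    \<alpha> dominates.\<close>
  ultimately have "\<bar>sin (t * \<alpha>) - p * sin \<alpha>\<bar> \<le> N * \<alpha> ^ 5 / 2" using R1 by linarith
  also have "\<dots> = N * \<alpha> ^ 4 * (\<alpha> / 2)" by (simp add: eval_nat_numeral)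
  also have "\<dots> \<le> N * \<alpha> ^ 4 * sin \<alpha>" using s t assms by (intro mult_left_mono) auto
  finally have "\<bar>sin (t * \<alpha>) - p * sin \<alpha>\<bar> / sin \<alpha> \<le> N * \<alpha> ^ 4" using s0 by (simp add: field_simps)
  moreover have "\<bar>sin (t * \<alpha>) - p * sin \<alpha>\<bar> / sin \<alpha> = \<bar>sin (t * \<alpha>) / sin \<alpha> - p\<bar>"
    using s0 by (simp add: abs_div_pos diff_divide_distrib)
  ultimately show ?thesis unfolding p_def N_def by simp
qed

text \<open>In x = |b - a|^2 instead of the angle, the main part is polynomial in the two points, so
  jets can be substituted into it. Replacing \<alpha>^2 by x costs O(x^2), which is O(h^4) as soon
  as the points are O(h) apart.\<close>

lemma slerp_expansion:
  fixes a b :: "real ^ 3"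
  assumes "norm a = 1" "norm b = 1" "norm (b - a) \<le> 1 / 2" "\<bar>t\<bar> \<le> M" "1 \<le> M"
  defines "x \<equiv> (norm (b - a))\<^sup>2"
  shows "norm (slerp a b t - (a + (t + t * (1 - t\<^sup>2) / 6 * x) *\<^sub>R (b - a) + (t * (1 - t) / 2 * x) *\<^sub>R a))
           \<le> 20 * M ^ 5 * x\<^sup>2"
proof (cases "b = a")
  case True
  then show ?thesis using assms by (simp add: slerp_def Log_S2_def Exp_S2_def)
next
  case False
  define \<alpha> where "\<alpha> = arccos (a \<bullet> b)"
  define \<phi> where "\<phi> = sin (t * \<alpha>) / sin \<alpha>"
  define N where "N = M ^ 5"
  note an = angle_of_close_unit_vectors[OF assms(1-3), folded \<alpha>_def]
  have x4: "(norm (b - a))^4 = x\<^sup>2" unfolding x_def by (simp flip: power_mult)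
  have c: "a \<bullet> b = 1 - x / 2" using inner_eq_norm_diff[OF assms(1,2)] by (simp add: x_def)
  have x0: "x > 0" unfolding x_def using False by simp
  have x1: "x \<le> 1 / 4" unfolding x_def using power_mono[OF assms(3), of 2] by (simp add: power2_eq_square)
  have "\<alpha> \<noteq> 0" using an c x0 by auto
  then have al: "0 < \<alpha>" "\<alpha> < pi" using an pi_gt3 by auto
  have al2: "\<bar>\<alpha>\<^sup>2 - x\<bar> \<le> x\<^sup>2" "\<alpha>\<^sup>2 \<le> 2 * x"
    using an(5)[unfolded x4, folded x_def] an(4)[folded x_def] .
  have al4: "\<alpha> ^ 4 \<le> 4 * x\<^sup>2"
    using power_mono[OF al2(2), of 2] by (simp add: power_mult_distrib flip: power_mult)
  have t: "\<bar>t\<bar> ^ 4 \<le> N" "\<bar>t\<bar> ^ 3 \<le> N" "\<bar>t\<bar> ^ 2 \<le> N" "\<bar>t\<bar> \<le> N" "1 \<le> N"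
    using abs_power_le_power[OF assms(4,5), of 4 5] abs_power_le_power[OF assms(4,5), of 3 5]
      abs_power_le_power[OF assms(4,5), of 2 5] abs_power_le_power[OF assms(4,5), of 1 5]
      abs_power_le_power[OF assms(4,5), of 0 5]
    unfolding N_def by auto
  have q: "\<bar>t * (1 - t\<^sup>2)\<bar> \<le> 2 * N"
  proof -
    have "t * (1 - t\<^sup>2) = t - t ^ 3" by (simp add: algebra_simps eval_nat_numeral)
    then show ?thesis using t abs_triangle_ineq4[of t "t ^ 3"] by (simp add: power_abs)
  qed
  define e1 where "e1 = \<phi> - (t + t * (1 - t\<^sup>2) / 6 * x)"
  have e1: "\<bar>e1\<bar> \<le> 5 * N * x\<^sup>2"
  proof -
    have "\<bar>\<phi> - (t + t * (1 - t\<^sup>2) / 6 * \<alpha>\<^sup>2)\<bar> \<le> N * \<alpha> ^ 4"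
      unfolding \<phi>_def N_def using sin_ratio_bound al an assms by simp
    also have "\<dots> \<le> N * (4 * x\<^sup>2)" using al4 t by (intro mult_left_mono) auto
    finally have 1: "\<bar>\<phi> - (t + t * (1 - t\<^sup>2) / 6 * \<alpha>\<^sup>2)\<bar> \<le> N * (4 * x\<^sup>2)" .
    have "\<bar>t * (1 - t\<^sup>2) / 6 * (\<alpha>\<^sup>2 - x)\<bar> = \<bar>t * (1 - t\<^sup>2)\<bar> / 6 * \<bar>\<alpha>\<^sup>2 - x\<bar>" by (simp add: abs_mult)
    also have "\<dots> \<le> 2 * N / 6 * x\<^sup>2" using q al2 t by (intro mult_mono divide_right_mono) auto
    also have "\<dots> \<le> N * x\<^sup>2" using t by simp
    finally have 2: "\<bar>t * (1 - t\<^sup>2) / 6 * (\<alpha>\<^sup>2 - x)\<bar> \<le> N * x\<^sup>2" .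
    have "e1 = (\<phi> - (t + t * (1 - t\<^sup>2) / 6 * \<alpha>\<^sup>2)) + t * (1 - t\<^sup>2) / 6 * (\<alpha>\<^sup>2 - x)"
      unfolding e1_def right_diff_distrib[of _ "\<alpha>\<^sup>2"] by simp
    then show ?thesis using 1 2 by linarith
  qed
  define e2 where "e2 = cos (t * \<alpha>) - (1 - t\<^sup>2 / 2 * x)"
  have e2: "\<bar>e2\<bar> \<le> N * x\<^sup>2"
  proof -
    have "\<bar>cos (t * \<alpha>) - (1 - t\<^sup>2 / 2 * \<alpha>\<^sup>2)\<bar> \<le> \<bar>t\<bar> ^ 4 * \<alpha> ^ 4 / 24"
      using cos_quadratic_bound[of "t * \<alpha>"] by (simp add: power_mult_distrib)
    also have "\<dots> \<le> N * (4 * x\<^sup>2) / 24" using t al4 by (intro divide_right_mono mult_mono) auto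
    finally have 1: "\<bar>cos (t * \<alpha>) - (1 - t\<^sup>2 / 2 * \<alpha>\<^sup>2)\<bar> \<le> N * (4 * x\<^sup>2) / 24" .
    have "\<bar>t\<^sup>2 / 2 * (\<alpha>\<^sup>2 - x)\<bar> = \<bar>t\<bar>^2 / 2 * \<bar>\<alpha>\<^sup>2 - x\<bar>" by (simp add: abs_mult)
    also have "\<dots> \<le> N / 2 * x\<^sup>2" using t al2 by (intro mult_mono divide_right_mono) auto
    finally have 2: "\<bar>t\<^sup>2 / 2 * (\<alpha>\<^sup>2 - x)\<bar> \<le> N / 2 * x\<^sup>2" .
    have "e2 = (cos (t * \<alpha>) - (1 - t\<^sup>2 / 2 * \<alpha>\<^sup>2)) - t\<^sup>2 / 2 * (\<alpha>\<^sup>2 - x)"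
      unfolding e2_def right_diff_distrib[of _ "\<alpha>\<^sup>2"] by simp
    moreover have "N * x\<^sup>2 \<ge> 0" using t by simp
    ultimately show ?thesis using 1 2 by linarith
  qed
  \<comment> \<open>This is the product of the x-term of the sine ratio with the normal component x
    / 2, of second order and hence part of the error. The first-order terms along a combine as - t^2
    / 2 + t / 2 = t (1 - t) / 2.\<close>
  define p where "p = t * (1 - t\<^sup>2) / 12 * x\<^sup>2"
  have p: "\<bar>p\<bar> \<le> N * x\<^sup>2"
  proof -
    have "\<bar>p\<bar> = \<bar>t * (1 - t\<^sup>2)\<bar> / 12 * x\<^sup>2" unfolding p_def by (simp add: abs_mult)
    also have "\<dots> \<le> 2 * N / 12 * x\<^sup>2" using q by (intro mult_right_mono divide_right_mono) auto
    also have "\<dots> \<le> N * x\<^sup>2" using t by simp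
    finally show ?thesis .
  qed
  define D where "D = slerp a b t - (a + (t + t * (1 - t\<^sup>2) / 6 * x) *\<^sub>R (b - a) + (t * (1 - t) / 2 * x) *\<^sub>R a)"
  have "slerp a b t = cos (t * \<alpha>) *\<^sub>R a + \<phi> *\<^sub>R (b - (a \<bullet> b) *\<^sub>R a)"
    unfolding \<phi>_def using slerp_formula al an assms by auto
  also have "\<dots> = (1 - t\<^sup>2 / 2 * x + e2) *\<^sub>R a + (t + t * (1 - t\<^sup>2) / 6 * x + e1) *\<^sub>R ((b - a) + (x / 2) *\<^sub>R a)"
    unfolding c e1_def e2_def by (simp add: algebra_simps)
  also have "\<dots> = (t + t * (1 - t\<^sup>2) / 6 * x + e1) *\<^sub>R (b - a)
      + (1 - t\<^sup>2 / 2 * x + e2 + (t + t * (1 - t\<^sup>2) / 6 * x + e1) * (x / 2)) *\<^sub>R a"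
    by (simp only: scaleR_add_right scaleR_add_left[of _ _ a] scaleR_scaleR) (simp only: ac_simps)
  also have "1 - t\<^sup>2 / 2 * x + e2 + (t + t * (1 - t\<^sup>2) / 6 * x + e1) * (x / 2)
      = 1 + t * (1 - t) / 2 * x + (e2 + e1 * x / 2 + p)"
    unfolding p_def by (simp add: field_simps power2_eq_square)
  finally have "D = e1 *\<^sub>R (b - a) + (e2 + e1 * x / 2 + p) *\<^sub>R a"
    unfolding D_def by (simp only: scaleR_add_left[of _ _ a] scaleR_add_left[of _ _ "b - a"]) simp
  then have "norm D \<le> \<bar>e1\<bar> * norm (b - a) + \<bar>e2 + e1 * x / 2 + p\<bar>"
    using assms(1) norm_triangle_ineq[of "e1 *\<^sub>R (b - a)" "(e2 + e1 * x / 2 + p) *\<^sub>R a"] by simp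
  moreover have "\<bar>e1\<bar> * norm (b - a) \<le> \<bar>e1\<bar>" using assms(3) by (intro mult_right_le_one_le) auto
  moreover have "\<bar>e1 * x / 2\<bar> \<le> \<bar>e1\<bar>" using x0 x1 mult_right_le_one_le[of "\<bar>e1\<bar>" "x/2"] by (simp add: abs_mult)
  moreover have "N * x\<^sup>2 \<ge> 0" using t by simp
  ultimately show ?thesis using e1 e2 p unfolding D_def[symmetric] N_def[symmetric] by linarith
qed

section \<open>Uniform remainders and jets\<close>

text \<open>The order of quantifiers carries the uniformity: neither the constant nor the range of
  small h depends on \<theta>.\<close>

definition unif_bigo :: "'b set \<Rightarrow> nat \<Rightarrow> (real \<Rightarrow> 'b \<Rightarrow> 'a::real_normed_vector) \<Rightarrow> bool" where
  "unif_bigo K n f \<longleftrightarrow> (\<exists>C. \<forall>\<^sub>F h in at_right 0. \<forall>\<theta>\<in>K. norm (f h \<theta>) \<le> C * h ^ n)"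

lemma eventually_at_right_0_less_1: "\<forall>\<^sub>F h in at_right (0::real). 0 < h \<and> h < 1"
  by (subst eventually_at_right[of 0 1]) (auto intro!: exI[of _ 1])

text \<open>A convenient normal form: a positive constant can be multiplied and divided by, and 0 <
  h < 1 makes higher powers of h smaller.\<close>

lemma unif_bigoE:
  assumes "unif_bigo K n f"
  obtains C where "C > 0" "\<forall>\<^sub>F h in at_right 0. 0 < h \<and> h < 1 \<and> (\<forall>\<theta>\<in>K. norm (f h \<theta>) \<le> C * h ^ n)"
proof -
  obtain C where C: "\<forall>\<^sub>F h in at_right 0. \<forall>\<theta>\<in>K. norm (f h \<theta>) \<le> C * h ^ n"
    using assms unfolding unif_bigo_def by blast
  have "\<forall>\<^sub>F h in at_right 0. 0 < h \<and> h < 1 \<and> (\<forall>\<theta>\<in>K. norm (f h \<theta>) \<le> max C 1 * h ^ n)"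
    using C eventually_at_right_0_less_1
    by eventually_elim (auto intro: order_trans mult_right_mono)
  then show ?thesis by (rule that[rotated]) simp
qed

lemma unif_bigo_bounded_by:
  assumes "unif_bigo K n g" "\<forall>\<^sub>F h in at_right 0. \<forall>\<theta>\<in>K. norm (f h \<theta>) \<le> c * norm (g h \<theta>)" "c \<ge> 0"
  shows "unif_bigo K n f"
proof -
  obtain C where "\<forall>\<^sub>F h in at_right 0. 0 < h \<and> h < 1 \<and> (\<forall>\<theta>\<in>K. norm (g h \<theta>) \<le> C * h ^ n)"
    using unif_bigoE[OF assms(1)] by blast
  with assms(2) have "\<forall>\<^sub>F h in at_right 0. \<forall>\<theta>\<in>K. norm (f h \<theta>) \<le> c * C * h ^ n"
    by eventually_elim (use assms(3) in \<open>force simp: mult.assoc intro: order_trans mult_left_mono\<close>)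
  then show ?thesis unfolding unif_bigo_def by blast
qed

lemma unif_bigo_cong:
  assumes "unif_bigo K n g" "\<forall>\<^sub>F h in at_right 0. \<forall>\<theta>\<in>K. f h \<theta> = g h \<theta>"
  shows "unif_bigo K n f"
  by (rule unif_bigo_bounded_by[OF assms(1), where c = 1])
     (use assms(2) in \<open>auto elim: eventually_mono\<close>)

text \<open>Restricting to positive h is what permits cancelling \<theta> h / (2 h) to \<theta> /
  2.\<close>

lemma unif_bigo_cong_gt_0:
  assumes "unif_bigo K n g" "\<And>h \<theta>. \<theta> \<in> K \<Longrightarrow> h > 0 \<Longrightarrow> f h \<theta> = g h \<theta>"
  shows "unif_bigo K n f"
  using eventually_at_right_0_less_1
  by (intro unif_bigo_cong[OF assms(1)]) (auto elim!: eventually_mono simp: assms(2))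

lemma unif_bigo_mono:
  assumes "unif_bigo K m f" "n \<le> m"
  shows "unif_bigo K n f"
proof -
  obtain C where C: "C > 0" "\<forall>\<^sub>F h in at_right 0. 0 < h \<and> h < 1 \<and> (\<forall>\<theta>\<in>K. norm (f h \<theta>) \<le> C * h ^ m)"
    using unif_bigoE[OF assms(1)] by blast
  from C(2) have "\<forall>\<^sub>F h in at_right 0. \<forall>\<theta>\<in>K. norm (f h \<theta>) \<le> C * h ^ n"
  proof eventually_elim
    case (elim h)
    then have "C * h ^ m \<le> C * h ^ n" using assms(2) C(1) by (simp add: power_decreasing)
    then show ?case using elim by force
  qed
  then show ?thesis unfolding unif_bigo_def by blast
qed

lemma unif_bigo_add:
  assumes "unif_bigo K n f" "unif_bigo K n g"
  shows "unif_bigo K n (\<lambda>h \<theta>. f h \<theta> + g h \<theta>)"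
proof -
  obtain C where C: "\<forall>\<^sub>F h in at_right 0. 0 < h \<and> h < 1 \<and> (\<forall>\<theta>\<in>K. norm (f h \<theta>) \<le> C * h ^ n)"
    using unif_bigoE[OF assms(1)] by blast
  obtain C' where C': "\<forall>\<^sub>F h in at_right 0. 0 < h \<and> h < 1 \<and> (\<forall>\<theta>\<in>K. norm (g h \<theta>) \<le> C' * h ^ n)"
    using unif_bigoE[OF assms(2)] by blast
  from C C' have "\<forall>\<^sub>F h in at_right 0. \<forall>\<theta>\<in>K. norm (f h \<theta> + g h \<theta>) \<le> (C + C') * h ^ n"
    by eventually_elim (auto simp: distrib_right intro!: norm_triangle_mono)
  then show ?thesis unfolding unif_bigo_def by blast
qed

text \<open>Orders add under any bounded bilinear operation, so scaling, inner product and real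
  product share one proof. The free order k lets each use state the accuracy it wants.\<close>

lemma unif_bigo_bilinear:
  assumes "bounded_bilinear op" "unif_bigo K m f" "unif_bigo K n g" "k \<le> m + n"
  shows "unif_bigo K k (\<lambda>h \<theta>. op (f h \<theta>) (g h \<theta>))"
proof -
  obtain B where B: "B > 0" "\<And>a b. norm (op a b) \<le> norm a * norm b * B"
    using bounded_bilinear.pos_bounded[OF assms(1)] by blast
  obtain C where C: "C > 0" "\<forall>\<^sub>F h in at_right 0. 0 < h \<and> h < 1 \<and> (\<forall>\<theta>\<in>K. norm (f h \<theta>) \<le> C * h ^ m)"
    using unif_bigoE[OF assms(2)] by blast
  obtain C' where C': "C' > 0" "\<forall>\<^sub>F h in at_right 0. 0 < h \<and> h < 1 \<and> (\<forall>\<theta>\<in>K. norm (g h \<theta>) \<le> C' * h ^ n)"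
    using unif_bigoE[OF assms(3)] by blast
  from C(2) C'(2) have "\<forall>\<^sub>F h in at_right 0. \<forall>\<theta>\<in>K. norm (op (f h \<theta>) (g h \<theta>)) \<le> (C * C' * B) * h ^ (m + n)"
  proof eventually_elim
    case (elim h)
    show ?case
    proof
      fix \<theta> assume "\<theta> \<in> K"
      then have "norm (f h \<theta>) * norm (g h \<theta>) * B \<le> (C * h ^ m) * (C' * h ^ n) * B"
        using elim B C(1) C'(1) by (intro mult_mono) auto
      also have "\<dots> = (C * C' * B) * h ^ (m + n)" by (simp add: power_add)
      finally show "norm (op (f h \<theta>) (g h \<theta>)) \<le> (C * C' * B) * h ^ (m + n)"
        using B(2) order_trans by blast
    qed
  qed
  then have "unif_bigo K (m + n) (\<lambda>h \<theta>. op (f h \<theta>) (g h \<theta>))"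
    unfolding unif_bigo_def by blast
  then show ?thesis using assms(4) by (rule unif_bigo_mono)
qed

lemmas unif_bigo_scaleR = unif_bigo_bilinear[OF bounded_bilinear_scaleR]
lemmas unif_bigo_inner = unif_bigo_bilinear[OF bounded_bilinear_inner]
lemmas unif_bigo_mult = unif_bigo_bilinear[OF bounded_bilinear_mult[where 'a = real]]

lemma unif_bigo_const: "unif_bigo K 0 (\<lambda>h \<theta>. c)"
  unfolding unif_bigo_def by (auto intro!: exI[of _ "norm c"])

lemma unif_bigo_power: "unif_bigo K n (\<lambda>h \<theta>. h ^ n)"
  unfolding unif_bigo_def using eventually_at_right_0_less_1
  by (intro exI[of _ 1]) (auto elim!: eventually_mono)

text \<open>Boundedness of K enters the estimates here; polynomials in \<theta> are then of order
  0.\<close>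

lemma unif_bigo_id:
  assumes "bounded K"
  shows "unif_bigo K 0 (\<lambda>h \<theta>. \<theta>)"
  using assms unfolding unif_bigo_def bounded_iff by (auto simp: eventually_const_iff)

lemma unif_bigo_uminus: "unif_bigo K n f \<Longrightarrow> unif_bigo K n (\<lambda>h \<theta>. - f h \<theta>)"
  unfolding unif_bigo_def by simp

lemma unif_bigo_diff: "unif_bigo K n f \<Longrightarrow> unif_bigo K n g \<Longrightarrow> unif_bigo K n (\<lambda>h \<theta>. f h \<theta> - g h \<theta>)"
  using unif_bigo_add[of K n f "\<lambda>h \<theta>. - g h \<theta>"] unif_bigo_uminus[of K n g] by simp

lemma unif_bigo_power_scaleR:
  assumes "unif_bigo K 0 f" "n \<le> m"
  shows "unif_bigo K n (\<lambda>h \<theta>. h ^ m *\<^sub>R f h \<theta>)"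
  using unif_bigo_scaleR[OF unif_bigo_power assms(1)] assms(2) by simp

text \<open>Brings points eventually within distance 1/2 or inside a given neighbourhood, where the
  local expansions apply.\<close>

lemma unif_bigo_small:
  assumes "unif_bigo K n f" "n > 0" "\<epsilon> > 0"
  shows "\<forall>\<^sub>F h in at_right 0. \<forall>\<theta>\<in>K. norm (f h \<theta>) \<le> \<epsilon>"
proof -
  have "unif_bigo K 1 f" using assms by (intro unif_bigo_mono[OF assms(1)]) auto
  then obtain C where C: "C > 0" "\<forall>\<^sub>F h in at_right 0. 0 < h \<and> h < 1 \<and> (\<forall>\<theta>\<in>K. norm (f h \<theta>) \<le> C * h ^ 1)"
    using unif_bigoE by blast
  have "\<forall>\<^sub>F h in at_right 0. h < \<epsilon> / C"
    using C(1) assms(3) eventually_at_right[of 0 1 "\<lambda>h. h < \<epsilon> / C"]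
    by (auto intro!: exI[of _ "\<epsilon> / C"])
  with C(2) show ?thesis
    by eventually_elim (use C(1) in \<open>force simp: field_simps\<close>)
qed

lemmas unif_bigo_0_intros =
  unif_bigo_add unif_bigo_diff unif_bigo_uminus unif_bigo_const
  unif_bigo_scaleR[where m = 0 and n = 0 and k = 0, simplified]
  unif_bigo_mult[where m = 0 and n = 0 and k = 0, simplified]
  unif_bigo_inner[where m = 0 and n = 0 and k = 0, simplified]

section \<open>Third-order jets and their interpolation\<close>

text \<open>All families share the constant term \<open>e\<close>, so the difference of two of them
  is O(h), as \<open>slerp_expansion\<close> needs for a remainder of order 4. The coefficients
  depend on \<theta> only and are bounded, so jets can be composed repeatedly.\<close>

definition sphere_jet ::
    "real set \<Rightarrow> real ^ 3 \<Rightarrow> (real \<Rightarrow> real \<Rightarrow> real ^ 3) \<Rightarrow>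
     (real \<Rightarrow> real ^ 3) \<Rightarrow> (real \<Rightarrow> real ^ 3) \<Rightarrow> (real \<Rightarrow> real ^ 3) \<Rightarrow> bool" where
  "sphere_jet K e f f1 f2 f3 \<longleftrightarrow>
     (\<forall>\<^sub>F h in at_right 0. \<forall>\<theta>\<in>K. norm (f h \<theta>) = 1) \<and>
     unif_bigo K 0 (\<lambda>h. f1) \<and> unif_bigo K 0 (\<lambda>h. f2) \<and> unif_bigo K 0 (\<lambda>h. f3) \<and>
     unif_bigo K 4 (\<lambda>h \<theta>. f h \<theta> - (e + h *\<^sub>R f1 \<theta> + h ^ 2 *\<^sub>R f2 \<theta> + h ^ 3 *\<^sub>R f3 \<theta>))"

lemma sphere_jet_cong:
  assumes "sphere_jet K e f f1 f2 f3"
    "\<And>\<theta>. \<theta> \<in> K \<Longrightarrow> f1 \<theta> = g1 \<theta>" "\<And>\<theta>. \<theta> \<in> K \<Longrightarrow> f2 \<theta> = g2 \<theta>" "\<And>\<theta>. \<theta> \<in> K \<Longrightarrow> f3 \<theta> = g3 \<theta>"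
  shows "sphere_jet K e f g1 g2 g3"
  using assms by (simp add: sphere_jet_def unif_bigo_def)

text \<open>Substitution into \<open>slerp_expansion\<close> with |b - a|^2 = h^2 n + 2 h^3 p +
  O(h^4). The \<alpha>-term starts at order 3 and sees only leading coefficients; the \<beta>-term
  starts at order 2 and so also meets the next coefficient of each factor.\<close>

lemma sphere_jet_slerp:
  fixes a1 a2 a3 b1 b2 b3 :: "real \<Rightarrow> real ^ 3"
  assumes a: "sphere_jet K e a a1 a2 a3" and b: "sphere_jet K e b b1 b2 b3"
    and t: "unif_bigo K 0 (\<lambda>h. t)"
  defines "n \<equiv> \<lambda>\<theta>. (b1 \<theta> - a1 \<theta>) \<bullet> (b1 \<theta> - a1 \<theta>)"
    and "p \<equiv> \<lambda>\<theta>. (b1 \<theta> - a1 \<theta>) \<bullet> (b2 \<theta> - a2 \<theta>)"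
    and "\<alpha> \<equiv> \<lambda>\<theta>. t \<theta> * (1 - (t \<theta>)\<^sup>2) / 6"
    and "\<beta> \<equiv> \<lambda>\<theta>. t \<theta> * (1 - t \<theta>) / 2"
  shows "sphere_jet K e (\<lambda>h \<theta>. slerp (a h \<theta>) (b h \<theta>) (t \<theta>))
     (\<lambda>\<theta>. a1 \<theta> + t \<theta> *\<^sub>R (b1 \<theta> - a1 \<theta>))
     (\<lambda>\<theta>. a2 \<theta> + t \<theta> *\<^sub>R (b2 \<theta> - a2 \<theta>) + (\<beta> \<theta> * n \<theta>) *\<^sub>R e)
     (\<lambda>\<theta>. a3 \<theta> + t \<theta> *\<^sub>R (b3 \<theta> - a3 \<theta>) + (\<alpha> \<theta> * n \<theta>) *\<^sub>R (b1 \<theta> - a1 \<theta>)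
           + \<beta> \<theta> *\<^sub>R (n \<theta> *\<^sub>R a1 \<theta> + (2 * p \<theta>) *\<^sub>R e))"
proof -
  define d1 d2 where "d1 = (\<lambda>\<theta>. b1 \<theta> - a1 \<theta>)" and "d2 = (\<lambda>\<theta>. b2 \<theta> - a2 \<theta>)"
  have d_eq: "b1 \<theta> - a1 \<theta> = d1 \<theta>" "b2 \<theta> - a2 \<theta> = d2 \<theta>" for \<theta>
    by (simp_all add: d1_def d2_def)
  have a': "\<forall>\<^sub>F h in at_right 0. \<forall>\<theta>\<in>K. norm (a h \<theta>) = 1"
     "unif_bigo K 0 (\<lambda>h. a1)" "unif_bigo K 0 (\<lambda>h. a2)" "unif_bigo K 0 (\<lambda>h. a3)"
    and b': "\<forall>\<^sub>F h in at_right 0. \<forall>\<theta>\<in>K. norm (b h \<theta>) = 1"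
     "unif_bigo K 0 (\<lambda>h. b1)" "unif_bigo K 0 (\<lambda>h. b2)" "unif_bigo K 0 (\<lambda>h. b3)"
    using a b by (auto simp: sphere_jet_def)
  have d: "unif_bigo K 0 (\<lambda>h. d1)" "unif_bigo K 0 (\<lambda>h. d2)"
    unfolding d1_def d2_def by (intro unif_bigo_0_intros a' b')+
  have np: "unif_bigo K 0 (\<lambda>h. n)" "unif_bigo K 0 (\<lambda>h. p)"
    unfolding n_def p_def by (intro unif_bigo_0_intros a' b')+
  have \<alpha>\<beta>: "unif_bigo K 0 (\<lambda>h. \<alpha>)" "unif_bigo K 0 (\<lambda>h. \<beta>)"
    unfolding \<alpha>_def \<beta>_def power2_eq_square divide_inverse by (intro unif_bigo_0_intros t)+
  define \<rho>a where "\<rho>a = (\<lambda>h \<theta>. a h \<theta> - (e + h *\<^sub>R a1 \<theta> + h ^ 2 *\<^sub>R a2 \<theta> + h ^ 3 *\<^sub>R a3 \<theta>))"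
  define \<rho>b where "\<rho>b = (\<lambda>h \<theta>. b h \<theta> - (e + h *\<^sub>R b1 \<theta> + h ^ 2 *\<^sub>R b2 \<theta> + h ^ 3 *\<^sub>R b3 \<theta>))"
  have \<rho>: "unif_bigo K 4 \<rho>a" "unif_bigo K 4 \<rho>b"
    using a b unfolding sphere_jet_def \<rho>a_def \<rho>b_def by auto
  define D where "D = (\<lambda>h \<theta>. b h \<theta> - a h \<theta>)"
  define x where "x = (\<lambda>h \<theta>. D h \<theta> \<bullet> D h \<theta>)"
  \<comment> \<open>From here the difference, the point a and the squared distance are truncated at
    several orders, each as accurately as its cofactors later require.\<close>
  have D3: "unif_bigo K 3 (\<lambda>h \<theta>. D h \<theta> - (h *\<^sub>R d1 \<theta> + h ^ 2 *\<^sub>R d2 \<theta>))"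
  proof -
    have "unif_bigo K 3 (\<lambda>h \<theta>. \<rho>b h \<theta> - \<rho>a h \<theta> + h ^ 3 *\<^sub>R (b3 \<theta> - a3 \<theta>))"
      by (intro unif_bigo_add unif_bigo_diff unif_bigo_power_scaleR unif_bigo_mono[OF \<rho>(1)]
            unif_bigo_mono[OF \<rho>(2)] a' b') auto
    then show ?thesis
      by (rule unif_bigo_cong_gt_0) (simp add: D_def d1_def d2_def \<rho>a_def \<rho>b_def algebra_simps)
  qed
  have D2: "unif_bigo K 2 (\<lambda>h \<theta>. D h \<theta> - h *\<^sub>R d1 \<theta>)"
    using unif_bigo_add[OF unif_bigo_mono[OF D3] unif_bigo_power_scaleR[OF d(2)], of 2 2]
    by (simp add: algebra_simps)
  have D1: "unif_bigo K 1 D"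
    using unif_bigo_add[OF unif_bigo_mono[OF D2] unif_bigo_power_scaleR[OF d(1)], of 1 1]
    by (simp add: algebra_simps)
  have A2: "unif_bigo K 2 (\<lambda>h \<theta>. a h \<theta> - e - h *\<^sub>R a1 \<theta>)"
  proof -
    have "unif_bigo K 2 (\<lambda>h \<theta>. \<rho>a h \<theta> + h ^ 2 *\<^sub>R a2 \<theta> + h ^ 3 *\<^sub>R a3 \<theta>)"
      by (intro unif_bigo_add unif_bigo_power_scaleR unif_bigo_mono[OF \<rho>(1)] a') auto
    then show ?thesis by (rule unif_bigo_cong_gt_0) (simp add: \<rho>a_def algebra_simps)
  qed
  have A1: "unif_bigo K 1 (\<lambda>h \<theta>. a h \<theta> - e)"
    using unif_bigo_add[OF unif_bigo_mono[OF A2] unif_bigo_power_scaleR[OF a'(2)], of 1 1]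
    by (simp add: algebra_simps)
  have A0: "unif_bigo K 0 a"
    using unif_bigo_add[OF unif_bigo_mono[OF A1] unif_bigo_const, of e] by (simp add: algebra_simps)
  have h1: "unif_bigo K 1 (\<lambda>h \<theta>. h *\<^sub>R d1 \<theta>)"
    using unif_bigo_power_scaleR[OF d(1), of 1 1] by simp
  have x2: "unif_bigo K 2 x"
    unfolding x_def by (rule unif_bigo_inner[OF D1 D1]) simp
  have x3: "unif_bigo K 3 (\<lambda>h \<theta>. x h \<theta> - h ^ 2 * n \<theta>)"
  proof -
    \<comment> \<open>With u . u - v . v = (u - v) . u + v . (u - v), a bound on u - v suffices; the
      same splitting serves for \<open>x4\<close>.\<close>
    have "unif_bigo K 3 (\<lambda>h \<theta>. (D h \<theta> - h *\<^sub>R d1 \<theta>) \<bullet> D h \<theta> + (h *\<^sub>R d1 \<theta>) \<bullet> (D h \<theta> - h *\<^sub>R d1 \<theta>))"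
      by (intro unif_bigo_add unif_bigo_inner[OF D2 D1] unif_bigo_inner[OF h1 D2]) auto
    then show ?thesis
      by (rule unif_bigo_cong_gt_0)
         (simp add: x_def n_def d_eq, simp add: inner_diff_left inner_diff_right power2_eq_square inner_commute algebra_simps)
  qed
  have x4: "unif_bigo K 4 (\<lambda>h \<theta>. x h \<theta> - (h ^ 2 * n \<theta> + 2 * h ^ 3 * p \<theta>))"
  proof -
    let ?m = "\<lambda>h \<theta>. h *\<^sub>R d1 \<theta> + h ^ 2 *\<^sub>R d2 \<theta>"
    have m: "unif_bigo K 1 ?m" by (intro unif_bigo_add h1 unif_bigo_power_scaleR d) auto
    \<comment> \<open>The last term is the part of \<open>?m\<close> squared that lies beyond order
      3 and is missing from the claimed expansion.\<close>
    have "unif_bigo K 4 (\<lambda>h \<theta>. (D h \<theta> - ?m h \<theta>) \<bullet> D h \<theta> + ?m h \<theta> \<bullet> (D h \<theta> - ?m h \<theta>) + h ^ 4 *\<^sub>R (d2 \<theta> \<bullet> d2 \<theta>))"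
      by (intro unif_bigo_add unif_bigo_inner[OF D3 D1] unif_bigo_inner[OF m D3] unif_bigo_power_scaleR unif_bigo_0_intros d) auto
    then show ?thesis
      by (rule unif_bigo_cong_gt_0)
         (simp add: x_def n_def p_def d_eq,
          simp add: inner_diff_left inner_diff_right inner_add_left inner_add_right eval_nat_numeral inner_commute algebra_simps)
  qed
  define E where "E = (\<lambda>h \<theta>. a h \<theta> + (t \<theta> + \<alpha> \<theta> * x h \<theta>) *\<^sub>R D h \<theta> + (\<beta> \<theta> * x h \<theta>) *\<^sub>R a h \<theta>)"
  have sl: "unif_bigo K 4 (\<lambda>h \<theta>. slerp (a h \<theta>) (b h \<theta>) (t \<theta>) - E h \<theta>)"
  proof -
    obtain C where C: "\<forall>\<^sub>F h in at_right (0::real). 0 < h \<and> h < 1 \<and> (\<forall>\<theta>\<in>K. norm (t \<theta>) \<le> C * h ^ 0)"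
      using unif_bigoE[OF t] by blast
    define M where "M = max C 1"
    have "unif_bigo K 4 (\<lambda>h \<theta>. x h \<theta> * x h \<theta>)"
      by (rule unif_bigo_mult[OF x2 x2]) simp
    moreover have "\<forall>\<^sub>F h in at_right 0. \<forall>\<theta>\<in>K. norm (slerp (a h \<theta>) (b h \<theta>) (t \<theta>) - E h \<theta>)
         \<le> (20 * M ^ 5) * norm (x h \<theta> * x h \<theta>)"
      using C a'(1) b'(1) unif_bigo_small[OF D1, of "1/2", simplified]
    proof eventually_elim
      case (elim h)
      show ?case
      proof
        fix \<theta> assume \<theta>: "\<theta> \<in> K"
        have M: "\<bar>t \<theta>\<bar> \<le> M" "1 \<le> M" using elim \<theta> unfolding M_def by force+
        show "norm (slerp (a h \<theta>) (b h \<theta>) (t \<theta>) - E h \<theta>) \<le> (20 * M ^ 5) * norm (x h \<theta> * x h \<theta>)"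
          using slerp_expansion[of "a h \<theta>" "b h \<theta>" "t \<theta>" M] elim \<theta> M
          by (simp add: E_def x_def D_def \<alpha>_def \<beta>_def power2_eq_square power2_norm_eq_inner[unfolded power2_eq_square])
      qed
    qed
    ultimately show ?thesis by (rule unif_bigo_bounded_by) (simp add: M_def)
  qed
  have nA: "unif_bigo K 4 (\<lambda>h \<theta>. (h ^ 2 *\<^sub>R n \<theta>) *\<^sub>R (a h \<theta> - e - h *\<^sub>R a1 \<theta>))"
    by (rule unif_bigo_scaleR[OF unif_bigo_power_scaleR[OF np(1) order.refl] A2]) simp
  have "unif_bigo K 0 (\<lambda>h \<theta>. 2 * p \<theta>)" by (intro unif_bigo_0_intros np)
  then have pA: "unif_bigo K 4 (\<lambda>h \<theta>. (h ^ 3 *\<^sub>R (2 * p \<theta>)) *\<^sub>R (a h \<theta> - e))"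
    by (rule unif_bigo_scaleR[OF unif_bigo_power_scaleR[OF _ order.refl] A1]) simp
  have Dx: "unif_bigo K 4 (\<lambda>h \<theta>. x h \<theta> *\<^sub>R (D h \<theta> - h *\<^sub>R d1 \<theta>))"
      "unif_bigo K 4 (\<lambda>h \<theta>. (x h \<theta> - h ^ 2 * n \<theta>) *\<^sub>R (h *\<^sub>R d1 \<theta>))"
      "unif_bigo K 4 (\<lambda>h \<theta>. (x h \<theta> - (h ^ 2 * n \<theta> + 2 * h ^ 3 * p \<theta>)) *\<^sub>R a h \<theta>)"
    by (rule unif_bigo_scaleR[OF x2 D2] unif_bigo_scaleR[OF x3 h1] unif_bigo_scaleR[OF x4 A0]; simp)+
  \<comment> \<open>This sum is \<open>E\<close> minus the claimed jet: the linear part leaves the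
    two remainders, and each product is telescoped factor by factor so that every summand contains
    one truncation error.\<close>
  have E: "unif_bigo K 4 (\<lambda>h \<theta>. \<rho>a h \<theta> + t \<theta> *\<^sub>R (\<rho>b h \<theta> - \<rho>a h \<theta>)
     + \<alpha> \<theta> *\<^sub>R (x h \<theta> *\<^sub>R (D h \<theta> - h *\<^sub>R d1 \<theta>) + (x h \<theta> - h ^ 2 * n \<theta>) *\<^sub>R (h *\<^sub>R d1 \<theta>))
     + \<beta> \<theta> *\<^sub>R ((x h \<theta> - (h ^ 2 * n \<theta> + 2 * h ^ 3 * p \<theta>)) *\<^sub>R a h \<theta>
        + (h ^ 2 *\<^sub>R n \<theta>) *\<^sub>R (a h \<theta> - e - h *\<^sub>R a1 \<theta>) + (h ^ 3 *\<^sub>R (2 * p \<theta>)) *\<^sub>R (a h \<theta> - e)))"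
    by (rule unif_bigo_add \<rho> unif_bigo_scaleR[OF t unif_bigo_diff[OF \<rho>(2,1)]]
          unif_bigo_scaleR[OF \<alpha>\<beta>(1) unif_bigo_add[OF Dx(1,2)]]
          unif_bigo_scaleR[OF \<alpha>\<beta>(2) unif_bigo_add[OF unif_bigo_add[OF Dx(3) nA] pA]] | simp)+
  have "unif_bigo K 4 (\<lambda>h \<theta>. slerp (a h \<theta>) (b h \<theta>) (t \<theta>) -
     (e + h *\<^sub>R (a1 \<theta> + t \<theta> *\<^sub>R (b1 \<theta> - a1 \<theta>))
     + h ^ 2 *\<^sub>R (a2 \<theta> + t \<theta> *\<^sub>R (b2 \<theta> - a2 \<theta>) + (\<beta> \<theta> * n \<theta>) *\<^sub>R e)
     + h ^ 3 *\<^sub>R (a3 \<theta> + t \<theta> *\<^sub>R (b3 \<theta> - a3 \<theta>) + (\<alpha> \<theta> * n \<theta>) *\<^sub>R (b1 \<theta> - a1 \<theta>)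
           + \<beta> \<theta> *\<^sub>R (n \<theta> *\<^sub>R a1 \<theta> + (2 * p \<theta>) *\<^sub>R e))))"
    by (rule unif_bigo_cong_gt_0[OF unif_bigo_add[OF sl E]])
       (simp add: E_def D_def \<rho>a_def \<rho>b_def d1_def eval_nat_numeral, simp add: algebra_simps)
  moreover have "\<forall>\<^sub>F h in at_right 0. \<forall>\<theta>\<in>K. norm (slerp (a h \<theta>) (b h \<theta>) (t \<theta>)) = 1"
    using a'(1) by eventually_elim (simp add: norm_slerp)
  moreover have "unif_bigo K 0 (\<lambda>h \<theta>. a1 \<theta> + t \<theta> *\<^sub>R (b1 \<theta> - a1 \<theta>))"
     "unif_bigo K 0 (\<lambda>h \<theta>. a2 \<theta> + t \<theta> *\<^sub>R (b2 \<theta> - a2 \<theta>) + (\<beta> \<theta> * n \<theta>) *\<^sub>R e)"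
     "unif_bigo K 0 (\<lambda>h \<theta>. a3 \<theta> + t \<theta> *\<^sub>R (b3 \<theta> - a3 \<theta>) + (\<alpha> \<theta> * n \<theta>) *\<^sub>R (b1 \<theta> - a1 \<theta>)
           + \<beta> \<theta> *\<^sub>R (n \<theta> *\<^sub>R a1 \<theta> + (2 * p \<theta>) *\<^sub>R e))"
    by (intro unif_bigo_0_intros a' b' \<alpha>\<beta> np t)+
  ultimately show ?thesis unfolding sphere_jet_def by simp
qed

section \<open>Curves on the sphere\<close>

lemma nth_vector_derivative_0 [simp]: "nth_vector_derivative 0 f = f"
  by (simp add: nth_vector_derivative_def)

lemma nth_vector_derivative_Suc:
  "nth_vector_derivative (Suc n) f t = vector_derivative (nth_vector_derivative n f) (at t)"
  by (simp add: nth_vector_derivative_def)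

lemma Ck_on_has_vector_derivative:
  assumes "Ck_on k f U" "j < k" "t \<in> U"
  shows "(nth_vector_derivative j f has_vector_derivative nth_vector_derivative (Suc j) f t) (at t)"
  using assms unfolding Ck_on_def nth_vector_derivative_Suc by (simp flip: vector_derivative_works)

text \<open>An iterated derivative at a point involves values on a neighbourhood. Working on an open
  set allows a formula for f that is valid only locally.\<close>

lemma nth_vector_derivative_eqI:
  assumes "open V" "\<And>t. t \<in> V \<Longrightarrow> f t = d 0 t"
    and "\<And>j t. j < n \<Longrightarrow> t \<in> V \<Longrightarrow> (d j has_vector_derivative d (Suc j) t) (at t)"
    and "t \<in> V"
  shows "nth_vector_derivative n f t = d n t"
proof -
  have "\<forall>t\<in>V. nth_vector_derivative k f t = d k t" if "k \<le> n" for k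
    using that
  proof (induction k)
    case (Suc k)
    show ?case
    proof
      fix t assume t: "t \<in> V"
      have "(nth_vector_derivative k f has_vector_derivative d (Suc k) t) (at t)"
        using Suc t assms(1,3) by (auto intro: has_vector_derivative_transform_within_open[of "d k" _ _ V])
      then show "nth_vector_derivative (Suc k) f t = d (Suc k) t"
        unfolding nth_vector_derivative_Suc by (rule vector_derivative_at)
    qed
  qed (use assms(2) in simp)
  then show ?thesis using assms(4) by simp
qed

text \<open>Leibniz rule for the factorization of the logarithm into a scalar series and a projected
  vector. Taking the derivatives as indexed families lets their explicit formulas be supplied from
  outside.\<close>

lemma nth_vector_derivative_3_scaleR:
  fixes q :: "nat \<Rightarrow> real \<Rightarrow> real" and w :: "nat \<Rightarrow> real \<Rightarrow> 'a::real_normed_vector"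
  assumes "open V" "t \<in> V" "\<And>t. t \<in> V \<Longrightarrow> f t = q 0 t *\<^sub>R w 0 t"
    and q: "\<And>j t. j < 3 \<Longrightarrow> t \<in> V \<Longrightarrow> (q j has_real_derivative q (Suc j) t) (at t)"
    and w: "\<And>j t. j < 3 \<Longrightarrow> t \<in> V \<Longrightarrow> (w j has_vector_derivative w (Suc j) t) (at t)"
  shows "nth_vector_derivative 3 f t =
     q 3 t *\<^sub>R w 0 t + (3 * q 2 t) *\<^sub>R w 1 t + (3 * q 1 t) *\<^sub>R w 2 t + q 0 t *\<^sub>R w 3 t"
proof -
  define d where "d = (\<lambda>k t. \<Sum>i\<le>k. real (k choose i) *\<^sub>R (q i t *\<^sub>R w (k - i) t))"
  have q': "(q 0 has_real_derivative q 1 t) (at t)" "(q 1 has_real_derivative q 2 t) (at t)"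
     "(q 2 has_real_derivative q 3 t) (at t)" if "t \<in> V" for t
    using q[of 0 t] q[of 1 t] q[of 2 t] that by (simp_all add: eval_nat_numeral)
  have w': "(w 0 has_vector_derivative w 1 t) (at t)" "(w 1 has_vector_derivative w 2 t) (at t)"
     "(w 2 has_vector_derivative w 3 t) (at t)" if "t \<in> V" for t
    using w[of 0 t] w[of 1 t] w[of 2 t] that by (simp_all add: eval_nat_numeral)
  have d0: "d 0 = (\<lambda>t. q 0 t *\<^sub>R w 0 t)"
    and d1: "d 1 = (\<lambda>t. q 0 t *\<^sub>R w 1 t + q 1 t *\<^sub>R w 0 t)"
    and d2: "d 2 = (\<lambda>t. q 0 t *\<^sub>R w 2 t + (2 *\<^sub>R (q 1 t *\<^sub>R w 1 t) + q 2 t *\<^sub>R w 0 t))"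
    and d3: "d 3 = (\<lambda>t. q 0 t *\<^sub>R w 3 t + (3 *\<^sub>R (q 1 t *\<^sub>R w 2 t) + (3 *\<^sub>R (q 2 t *\<^sub>R w 1 t) + q 3 t *\<^sub>R w 0 t)))"
    by (simp_all add: d_def eval_nat_numeral add.assoc)
  have "(d j has_vector_derivative d (Suc j) t) (at t)" if "j < 3" "t \<in> V" for j t
  proof -
    have 0: "(d 0 has_vector_derivative d 1 t) (at t)"
      unfolding d0 d1
      by (rule derivative_eq_intros q'[OF that(2)] w'[OF that(2)] refl | simp)+
    have "(d 1 has_vector_derivative q 0 t *\<^sub>R w 2 t + q 1 t *\<^sub>R w 1 t + (q 1 t *\<^sub>R w 1 t + q 2 t *\<^sub>R w 0 t)) (at t)"
      unfolding d1 by (intro derivative_intros q'[OF that(2)] w'[OF that(2)])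
    then have 1: "(d 1 has_vector_derivative d 2 t) (at t)"
      by (simp only: d2 scaleR_2 ac_simps)
    have "(d 2 has_vector_derivative q 0 t *\<^sub>R w 3 t + q 1 t *\<^sub>R w 2 t
        + (2 *\<^sub>R (q 1 t *\<^sub>R w 2 t + q 2 t *\<^sub>R w 1 t) + (q 2 t *\<^sub>R w 1 t + q 3 t *\<^sub>R w 0 t))) (at t)"
      unfolding d2
      by (intro derivative_intros bounded_linear.has_vector_derivative[OF bounded_linear_scaleR_right]
           q'[OF that(2)] w'[OF that(2)])
    moreover have "3 *\<^sub>R x = x + 2 *\<^sub>R x" for x :: 'a
      using scaleR_left.add[of 1 2 x] by simp
    ultimately have 2: "(d 2 has_vector_derivative d 3 t) (at t)"
      by (simp only: d3 scaleR_right_distrib ac_simps)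
    have "j = 0 \<or> j = 1 \<or> j = 2" using that by auto
    then show ?thesis using 0 1 2 by (auto simp: eval_nat_numeral)
  qed
  then have "nth_vector_derivative 3 f t = d 3 t"
    by (intro nth_vector_derivative_eqI[where V = V]) (auto simp: assms(1-3) d0)
  then show ?thesis by (simp add: d3)
qed

lemma has_real_derivative_inner:
  assumes "(f has_vector_derivative f') (at t)" "(g has_vector_derivative g') (at t)"
  shows "((\<lambda>x. f x \<bullet> g x) has_real_derivative f t \<bullet> g' + f' \<bullet> g t) (at t)"
  using bounded_bilinear.has_vector_derivative[OF bounded_bilinear_inner assms]
  by (simp add: has_real_derivative_iff_has_vector_derivative)

lemma has_real_derivative_locally_const_eq_0:
  fixes f :: "real \<Rightarrow> real"
  assumes "(f has_real_derivative D) (at t)" "open U" "t \<in> U" "\<And>x. x \<in> U \<Longrightarrow> f x = c"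
  shows "D = 0"
proof -
  have "((\<lambda>x. c) has_real_derivative D) (at t)"
    using assms by (auto intro: has_field_derivative_transform_within_open[of f _ _ U])
  then show ?thesis using DERIV_unique DERIV_const by blast
qed

section \<open>Spherical curves in normal coordinates\<close>

text \<open>Differentiate \<gamma> . \<gamma> = 1 three times. Each identity is first obtained on
  all of \<open>U\<close>, which makes it available for the next differentiation.\<close>

lemma spherical_curve_derivatives:
  fixes \<gamma> :: "real \<Rightarrow> 'a::real_inner"
  assumes U: "open U" and \<gamma>: "\<gamma> ` U \<subseteq> sphere 0 1" and "Ck_on 4 \<gamma> U" and "t \<in> U"
  defines "D \<equiv> \<lambda>k. nth_vector_derivative k \<gamma>"
  shows "\<gamma> t \<bullet> D 1 t = 0" "\<gamma> t \<bullet> D 2 t = - (D 1 t \<bullet> D 1 t)" "\<gamma> t \<bullet> D 3 t = - 3 * (D 1 t \<bullet> D 2 t)"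
proof -
  have D: "(\<gamma> has_vector_derivative D 1 t) (at t)" "(D 1 has_vector_derivative D 2 t) (at t)"
     "(D 2 has_vector_derivative D 3 t) (at t)" if "t \<in> U" for t
    using Ck_on_has_vector_derivative[OF assms(3) _ that, of 0]
      Ck_on_has_vector_derivative[OF assms(3) _ that, of 1] Ck_on_has_vector_derivative[OF assms(3) _ that, of 2]
    by (auto simp: D_def eval_nat_numeral)
  have "\<gamma> t \<bullet> \<gamma> t = 1" if "t \<in> U" for t using \<gamma> that by (auto simp: norm_eq_1)
  then have 1: "\<gamma> t \<bullet> D 1 t = 0" if "t \<in> U" for t
    using has_real_derivative_locally_const_eq_0[OF has_real_derivative_inner[OF D(1) D(1)] U that, where c = 1] that
    by (simp add: inner_commute)
  have 2: "\<gamma> t \<bullet> D 2 t + D 1 t \<bullet> D 1 t = 0" if "t \<in> U" for t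
    using has_real_derivative_locally_const_eq_0[OF has_real_derivative_inner[OF D(1) D(2)] U that, where c = 0] that 1
    by simp
  have 3: "\<gamma> t \<bullet> D 3 t + 3 * (D 1 t \<bullet> D 2 t) = 0" if "t \<in> U" for t
    using has_real_derivative_locally_const_eq_0[OF
      DERIV_add[OF has_real_derivative_inner[OF D(1) D(3)] has_real_derivative_inner[OF D(2) D(2)]] U that, where c = 0] that 2
    by (simp add: inner_commute)
  show "\<gamma> t \<bullet> D 1 t = 0" "\<gamma> t \<bullet> D 2 t = - (D 1 t \<bullet> D 1 t)" "\<gamma> t \<bullet> D 3 t = - 3 * (D 1 t \<bullet> D 2 t)"
    using 1[OF assms(4)] 2[OF assms(4)] 3[OF assms(4)] by linarith+
qed

text \<open>At \<eta> = 0 the projection \<open>w 0\<close> and the slope \<open>q 1\<close> vanish,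
  so Leibniz leaves 3 q'' w' + q w'''. The value 1/3 of the first derivative of the series gives the
  term |D1|^2 D1, and projecting the third derivative adds the multiple of the base point.\<close>

lemma normal_curve_third_derivative:
  fixes \<gamma> :: "real \<Rightarrow> real ^ 3"
  assumes U: "open U" and \<gamma>: "\<gamma> ` U \<subseteq> S2" and Ck: "Ck_on 4 \<gamma> U" and s: "s \<in> U"
  defines "D \<equiv> \<lambda>k. nth_vector_derivative k \<gamma>"
  shows "nth_vector_derivative 3 (normal_curve \<gamma> s) 0 =
    (D 1 s \<bullet> D 1 s) *\<^sub>R D 1 s + D 3 s + (3 * (D 1 s \<bullet> D 2 s)) *\<^sub>R \<gamma> s"
proof -
  define c where "c = (\<lambda>k \<eta>. \<gamma> s \<bullet> D k (s + \<eta>))"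
  define u where "u = (\<lambda>\<eta>. 1 - c 0 \<eta>)"
  define w where "w = (\<lambda>k \<eta>. D k (s + \<eta>) - c k \<eta> *\<^sub>R \<gamma> s)"
  \<comment> \<open>The series composed with \<open>u\<close>, followed by its first three
    derivatives by the chain rule with u' = - \<open>c 1\<close>.\<close>
  define q where "q = (\<lambda>k \<eta>. [logser 0 (u \<eta>), - logser 1 (u \<eta>) * c 1 \<eta>,
    logser 2 (u \<eta>) * (c 1 \<eta>)\<^sup>2 - logser 1 (u \<eta>) * c 2 \<eta>,
    - logser 3 (u \<eta>) * c 1 \<eta> ^ 3 + 3 * logser 2 (u \<eta>) * c 1 \<eta> * c 2 \<eta> - logser 1 (u \<eta>) * c 3 \<eta>] ! k)"
  \<comment> \<open>The open hemisphere around the base point, pulled back to the parameter; the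
    series formula for the logarithm holds there.\<close>
  define V where "V = {\<eta>. s + \<eta> \<in> U \<and> c 0 \<eta> > 0}"
  have D: "((\<lambda>\<eta>. D k (s + \<eta>)) has_vector_derivative D (Suc k) (s + \<eta>)) (at \<eta>)" if "k < 4" "s + \<eta> \<in> U" for k \<eta>
  proof -
    have "((\<lambda>\<eta>. s + \<eta>) has_vector_derivative 1) (at \<eta>)"
      by (rule derivative_eq_intros refl | simp)+
    from vector_diff_chain_at[OF this Ck_on_has_vector_derivative[OF Ck that]]
    show ?thesis by (simp add: D_def o_def)
  qed
  have c: "(c k has_real_derivative c (Suc k) \<eta>) (at \<eta>)" if "k < 4" "s + \<eta> \<in> U" for k \<eta>
    unfolding c_def using has_real_derivative_inner[OF has_vector_derivative_const D[OF that], of "\<gamma> s"] by simp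
  have w: "(w k has_vector_derivative w (Suc k) \<eta>) (at \<eta>)" if "k < 4" "s + \<eta> \<in> U" for k \<eta>
    unfolding w_def
    using has_vector_derivative_diff[OF D[OF that]
        has_vector_derivative_scaleR[OF c[OF that] has_vector_derivative_const]] by simp
  have norm1: "norm (\<gamma> t) = 1" if "t \<in> U" for t using \<gamma> that by auto
  have V: "open V"
  proof -
    have W: "open {\<eta>. s + \<eta> \<in> U}"
      using open_vimage[OF U, of "\<lambda>\<eta>. s + \<eta>"] by (simp add: vimage_def continuous_intros)
    have "continuous_on {\<eta>. s + \<eta> \<in> U} (c 0)"
      by (intro continuous_at_imp_continuous_on ballI DERIV_isCont[OF c]) auto
    then have "open (c 0 -` {0<..} \<inter> {\<eta>. s + \<eta> \<in> U})"
      by (rule continuous_on_open_vimage[OF W, THEN iffD1, rule_format, OF _ open_greaterThan])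
    moreover have "c 0 -` {0<..} \<inter> {\<eta>. s + \<eta> \<in> U} = V" unfolding V_def by auto
    ultimately show ?thesis by simp
  qed
  have "c 0 0 = 1" using norm1[OF s] by (simp add: c_def D_def norm_eq_1)
  then have V0: "0 \<in> V" using s by (simp add: V_def)
  have u: "\<bar>u \<eta>\<bar> < 1" if "\<eta> \<in> V" for \<eta>
    using norm_one_inner_bounds[OF norm1[OF s] norm1[of "s + \<eta>"]] that
    by (auto simp: u_def V_def c_def D_def)
  have l: "((\<lambda>\<eta>. logser k (u \<eta>)) has_real_derivative - (logser (Suc k) (u \<eta>) * c 1 \<eta>)) (at \<eta>)"
    if "\<eta> \<in> V" for k \<eta>
  proof -
    have "(u has_real_derivative 0 - c 1 \<eta>) (at \<eta>)"
      unfolding u_def using DERIV_diff[OF DERIV_const c[of 0 \<eta>]] that by (simp add: V_def)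
    from DERIV_chain2[OF logser_has_derivative[OF u[OF that]] this] show ?thesis by simp
  qed
  have c': "(c 1 has_real_derivative c 2 \<eta>) (at \<eta>)" "(c 2 has_real_derivative c 3 \<eta>) (at \<eta>)" if "\<eta> \<in> V" for \<eta>
    using c[of 1 \<eta>] c[of 2 \<eta>] that by (auto simp: V_def eval_nat_numeral)
  have q: "(q j has_real_derivative q (Suc j) \<eta>) (at \<eta>)" if "j < 3" "\<eta> \<in> V" for j \<eta>
  proof -
    have l': "((\<lambda>\<eta>. logser 0 (u \<eta>)) has_real_derivative - (logser 1 (u \<eta>) * c 1 \<eta>)) (at \<eta>)"
        "((\<lambda>\<eta>. logser 1 (u \<eta>)) has_real_derivative - (logser 2 (u \<eta>) * c 1 \<eta>)) (at \<eta>)"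
        "((\<lambda>\<eta>. logser 2 (u \<eta>)) has_real_derivative - (logser 3 (u \<eta>) * c 1 \<eta>)) (at \<eta>)"
      using l[OF that(2), of 0] l[OF that(2), of 1] l[OF that(2), of 2] by (simp_all add: eval_nat_numeral)
    have 0: "(q 0 has_real_derivative q (Suc 0) \<eta>) (at \<eta>)"
      unfolding q_def using l'(1) by simp
    have 1: "(q 1 has_real_derivative q (Suc 1) \<eta>) (at \<eta>)"
      unfolding q_def nth_Cons_Suc nth_Cons_0 One_nat_def
      by (rule derivative_eq_intros l'[unfolded One_nat_def] c'[OF that(2), unfolded One_nat_def] refl | simp add: power2_eq_square algebra_simps)+
    have 2: "(q 2 has_real_derivative q (Suc 2) \<eta>) (at \<eta>)"
    proof -
      have "((\<lambda>\<eta>. logser 2 (u \<eta>) * (c 1 \<eta>)\<^sup>2 - logser 1 (u \<eta>) * c 2 \<eta>) has_real_derivative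
       - logser 3 (u \<eta>) * c 1 \<eta> ^ 3 + 3 * logser 2 (u \<eta>) * c 1 \<eta> * c 2 \<eta> - logser 1 (u \<eta>) * c 3 \<eta>) (at \<eta>)"
        by (rule derivative_eq_intros l' c'[OF that(2)] refl | simp add: eval_nat_numeral algebra_simps)+
      then show ?thesis by (simp add: q_def eval_nat_numeral)
    qed
    have "j = 0 \<or> j = 1 \<or> j = 2" using that by auto
    then show ?thesis using 0 1 2 by auto
  qed
  have X: "normal_curve \<gamma> s \<eta> = q 0 \<eta> *\<^sub>R w 0 \<eta>" if "\<eta> \<in> V" for \<eta>
    using Log_S2_eq_logser[OF norm1[OF s] norm1[of "s + \<eta>"]] that
    by (simp add: normal_curve_def q_def w_def u_def c_def D_def V_def)
  have "nth_vector_derivative 3 (normal_curve \<gamma> s) 0 =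
     q 3 0 *\<^sub>R w 0 0 + (3 * q 2 0) *\<^sub>R w 1 0 + (3 * q 1 0) *\<^sub>R w 2 0 + q 0 0 *\<^sub>R w 3 0"
    by (rule nth_vector_derivative_3_scaleR[OF V V0 X q w]) (auto simp: V_def)
  moreover note rel = spherical_curve_derivatives[OF U \<gamma> Ck s]
  have "c 0 0 = 1" "c 1 0 = 0" "c 2 0 = - (D 1 s \<bullet> D 1 s)" "c 3 0 = - 3 * (D 1 s \<bullet> D 2 s)" "u 0 = 0"
    using norm1[OF s] rel by (auto simp: c_def u_def D_def norm_eq_1)
  moreover from this have "w 0 0 = 0" "w 1 0 = D 1 s" "w 3 0 = D 3 s + (3 * (D 1 s \<bullet> D 2 s)) *\<^sub>R \<gamma> s"
    by (simp_all add: w_def) (simp add: D_def)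
  moreover from calculation have "q 0 0 = 1" "q 1 0 = 0" "q 2 0 = (D 1 s \<bullet> D 1 s) / 3"
    using logser_at_0 by (simp_all add: q_def)
  ultimately show ?thesis by simp
qed

section \<open>Taylor expansion with bounded remainder\<close>

text \<open>The Lagrange remainder is a scalar statement, so it is applied to the curve paired with
  its own remainder vector R at the given t. This bounds |R|^2 by a multiple of t^4 |R|. The
  estimate is two-sided because \<theta> may be negative.\<close>

lemma curve_taylor:
  fixes f :: "real \<Rightarrow> 'a::real_inner"
  assumes "open U" "0 \<in> U" "Ck_on 4 f U"
  defines "D \<equiv> \<lambda>k. nth_vector_derivative k f"
  obtains C \<rho> where "\<rho> > 0" "\<And>t. \<bar>t\<bar> \<le> \<rho> \<Longrightarrow> t \<in> U"
     "\<And>t. \<bar>t\<bar> \<le> \<rho> \<Longrightarrow> norm (f t - (f 0 + t *\<^sub>R D 1 0 + (t\<^sup>2 / 2) *\<^sub>R D 2 0 + (t ^ 3 / 6) *\<^sub>R D 3 0)) \<le> C * \<bar>t\<bar> ^ 4"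
proof -
  obtain \<rho> where \<rho>: "\<rho> > 0" "cball 0 \<rho> \<subseteq> U" using assms open_contains_cball by blast
  then have U: "t \<in> U" if "\<bar>t\<bar> \<le> \<rho>" for t using that by (auto simp: subset_iff)
  have "continuous_on (cball 0 \<rho>) (D 4)"
    using assms(3) \<rho> continuous_on_subset unfolding Ck_on_def D_def by blast
  then have "bounded (D 4 ` cball 0 \<rho>)"
    by (intro compact_imp_bounded compact_continuous_image) auto
  then obtain M where "\<forall>t\<in>cball 0 \<rho>. norm (D 4 t) \<le> M"
    unfolding bounded_iff by auto
  then have M: "norm (D 4 t) \<le> M" if "\<bar>t\<bar> \<le> \<rho>" for t using that by simp
  have "norm (f t - (f 0 + t *\<^sub>R D 1 0 + (t\<^sup>2 / 2) *\<^sub>R D 2 0 + (t ^ 3 / 6) *\<^sub>R D 3 0)) \<le> M / 24 * \<bar>t\<bar> ^ 4"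
    if t: "\<bar>t\<bar> \<le> \<rho>" for t
  proof -
    define R where "R = f t - (f 0 + t *\<^sub>R D 1 0 + (t\<^sup>2 / 2) *\<^sub>R D 2 0 + (t ^ 3 / 6) *\<^sub>R D 3 0)"
    have "DERIV (\<lambda>x. D m x \<bullet> R) x :> D (Suc m) x \<bullet> R" if "m < 4" "\<bar>x\<bar> \<le> \<bar>t\<bar>" for m x
      using has_real_derivative_inner[OF Ck_on_has_vector_derivative[OF assms(3) that(1)] has_vector_derivative_const]
       that t U by (simp add: D_def)
    then obtain \<xi> where \<xi>: "\<bar>\<xi>\<bar> \<le> \<bar>t\<bar>"
      "D 0 t \<bullet> R = (\<Sum>m<4. (D m 0 \<bullet> R) / fact m * t ^ m) + (D 4 \<xi> \<bullet> R) / fact 4 * t ^ 4"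
      using Maclaurin_bi_le[of "\<lambda>m x. D m x \<bullet> R" "\<lambda>x. D 0 x \<bullet> R" 4 t] by auto
    have "{..<4::nat} = {0, 1, 2, 3}" by auto
    with \<xi>(2) have "R \<bullet> R = (D 4 \<xi> \<bullet> R) / 24 * t ^ 4"
      by (subst R_def) (simp add: D_def inner_diff_left inner_add_left fact_numeral)
    then have "norm R * norm R = \<bar>(D 4 \<xi> \<bullet> R) / 24 * t ^ 4\<bar>"
      by (metis abs_of_nonneg inner_ge_zero power2_eq_square power2_norm_eq_inner)
    also have "\<dots> = \<bar>D 4 \<xi> \<bullet> R\<bar> / 24 * \<bar>t\<bar> ^ 4" by (simp add: abs_mult power_abs)
    also have "\<bar>D 4 \<xi> \<bullet> R\<bar> \<le> M * norm R"
      using M[of \<xi>] \<xi>(1) t Cauchy_Schwarz_ineq2[of "D 4 \<xi>" R]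
      by (meson order_trans mult_right_mono norm_ge_zero)
    then have "\<bar>D 4 \<xi> \<bullet> R\<bar> / 24 * \<bar>t\<bar> ^ 4 \<le> (M * norm R) / 24 * \<bar>t\<bar> ^ 4"
      by (intro mult_right_mono divide_right_mono) auto
    finally have "norm R * norm R \<le> (M / 24 * \<bar>t\<bar> ^ 4) * norm R" by (simp add: algebra_simps)
    moreover have "0 \<le> M" using order_trans[OF norm_ge_zero M[of 0]] \<rho>(1) by simp
    ultimately show ?thesis unfolding R_def[symmetric]
      by (cases "R = 0") auto
  qed
  then show ?thesis using that \<rho>(1) U by blast
qed

section \<open>The SIDER2 interpolant\<close>

text \<open>Here v, a, j are the first three derivatives of the curve at 0. In flat space the recipe
  is a de Casteljau form of the quadratic through the nodes, with cubic defect - \<theta> (\<theta>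
  - 1) (\<theta> - 2) j / 6; the curvature corrections complete j to \<open>B\<close>.\<close>

lemma sphere_jet_sider2:
  fixes p0 p1 p2 :: "real \<Rightarrow> real \<Rightarrow> real ^ 3"
  assumes K: "bounded K" and ev: "e \<bullet> v = 0"
    and p0: "sphere_jet K e p0 (\<lambda>\<theta>. 0) (\<lambda>\<theta>. 0) (\<lambda>\<theta>. 0)"
    and p1: "sphere_jet K e p1 (\<lambda>\<theta>. v) (\<lambda>\<theta>. (1 / 2) *\<^sub>R a) (\<lambda>\<theta>. (1 / 6) *\<^sub>R j)"
    and p2: "sphere_jet K e p2 (\<lambda>\<theta>. 2 *\<^sub>R v) (\<lambda>\<theta>. 2 *\<^sub>R a) (\<lambda>\<theta>. (4 / 3) *\<^sub>R j)"
  defines "B \<equiv> (v \<bullet> v) *\<^sub>R v + j + (3 * (v \<bullet> a)) *\<^sub>R e"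
  shows "sphere_jet K e
     (\<lambda>h \<theta>. slerp (slerp (p0 h \<theta>) (sider2_da (p1 h \<theta>) (p2 h \<theta>)) (\<theta> / 2))
                  (slerp (sider2_db (p0 h \<theta>) (p1 h \<theta>)) (p2 h \<theta>) (\<theta> / 2)) (\<theta> / 2))
     (\<lambda>\<theta>. \<theta> *\<^sub>R v) (\<lambda>\<theta>. (\<theta>\<^sup>2 / 2) *\<^sub>R a)
     (\<lambda>\<theta>. (\<theta> ^ 3 / 6) *\<^sub>R j - (\<theta> * (\<theta> - 1) * (\<theta> - 2) / 6) *\<^sub>R B)"
proof -
  define q p where "q = v \<bullet> v" and "p = v \<bullet> a"
  \<comment> \<open>For a spherical curve with base point \<open>e\<close> this is the tangential
    part of the acceleration.\<close>
  define A where "A = a + q *\<^sub>R e"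
  have ip: "v \<bullet> v = q" "v \<bullet> a = p" "a \<bullet> v = p" "e \<bullet> v = 0" "v \<bullet> e = 0"
    using ev by (simp_all add: q_def p_def inner_commute)
  note ip = ip inner_diff_left inner_diff_right inner_add_left inner_add_right
  have B: "B = q *\<^sub>R v + j + (3 * p) *\<^sub>R e" by (simp add: B_def q_def p_def)
  have \<tau>: "unif_bigo K 0 (\<lambda>h \<theta>. \<theta> / 2)"
    unfolding divide_inverse by (intro unif_bigo_0_intros unif_bigo_id K)
  \<comment> \<open>At t = 2 both correction factors are -1. Extrapolating from p2 through p1
    returns to \<open>e\<close> at first order, since 2 v + 2 (v - 2 v) = 0; the higher-order
    defects are - \<open>A\<close> and - \<open>B\<close>.\<close>
  have da: "sphere_jet K e (\<lambda>h \<theta>. sider2_da (p1 h \<theta>) (p2 h \<theta>)) (\<lambda>\<theta>. 0) (\<lambda>\<theta>. - A) (\<lambda>\<theta>. - B)"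
    unfolding sider2_da_def
    by (rule sphere_jet_cong[OF sphere_jet_slerp[OF p2 p1 unif_bigo_const]])
       (simp_all add: ip A_def B vec_eq_iff field_simps)
  have db: "sphere_jet K e (\<lambda>h \<theta>. sider2_db (p0 h \<theta>) (p1 h \<theta>)) (\<lambda>\<theta>. 2 *\<^sub>R v) (\<lambda>\<theta>. a - q *\<^sub>R e)
      (\<lambda>\<theta>. (1 / 3) *\<^sub>R j - p *\<^sub>R e - q *\<^sub>R v)"
    unfolding sider2_db_def
    by (rule sphere_jet_cong[OF sphere_jet_slerp[OF p0 p1 unif_bigo_const]])
       (simp_all add: ip A_def B vec_eq_iff field_simps)
  \<comment> \<open>In this and the next interpolation the two ends have equal first-order
    coefficients, so slerp acts linearly on the jets. Among the three interpolations at \<theta> /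
    2, only the outer one, with ends differing by 2 v, adds curvature terms.\<close>
  have L: "sphere_jet K e (\<lambda>h \<theta>. slerp (p0 h \<theta>) (sider2_da (p1 h \<theta>) (p2 h \<theta>)) (\<theta> / 2))
      (\<lambda>\<theta>. 0) (\<lambda>\<theta>. - (\<theta> / 2) *\<^sub>R A) (\<lambda>\<theta>. - (\<theta> / 2) *\<^sub>R B)"
    by (rule sphere_jet_cong[OF sphere_jet_slerp[OF p0 da \<tau>]]) simp_all
  have R: "sphere_jet K e (\<lambda>h \<theta>. slerp (sider2_db (p0 h \<theta>) (p1 h \<theta>)) (p2 h \<theta>) (\<theta> / 2))
      (\<lambda>\<theta>. 2 *\<^sub>R v) (\<lambda>\<theta>. a - q *\<^sub>R e + (\<theta> / 2) *\<^sub>R A)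
      (\<lambda>\<theta>. (1 / 3) *\<^sub>R j - p *\<^sub>R e - q *\<^sub>R v + (\<theta> / 2) *\<^sub>R (j + p *\<^sub>R e + q *\<^sub>R v))"
    by (rule sphere_jet_cong[OF sphere_jet_slerp[OF db p2 \<tau>]])
       (simp_all add: ip A_def, simp_all add: vec_eq_iff field_simps)
  show ?thesis
    by (rule sphere_jet_cong[OF sphere_jet_slerp[OF L R \<tau>]])
       (simp_all only: ip A_def B inner_scaleR_left inner_scaleR_right inner_minus_left inner_minus_right,
        simp_all add: ip vec_eq_iff field_simps eval_nat_numeral)
qed

text \<open>Letting k depend on \<theta> covers both uses: k = \<theta> for the moving point and
  constant k for the nodes.\<close>

lemma sphere_jet_curve:
  fixes \<gamma> :: "real \<Rightarrow> real ^ 3"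
  assumes "open U" "0 \<in> U" "\<gamma> ` U \<subseteq> S2" "Ck_on 4 \<gamma> U" and k: "unif_bigo K 0 (\<lambda>h. k)"
  defines "D \<equiv> \<lambda>k. nth_vector_derivative k \<gamma>"
  shows "sphere_jet K (\<gamma> 0) (\<lambda>h \<theta>. \<gamma> (k \<theta> * h)) (\<lambda>\<theta>. k \<theta> *\<^sub>R D 1 0)
     (\<lambda>\<theta>. ((k \<theta>)\<^sup>2 / 2) *\<^sub>R D 2 0) (\<lambda>\<theta>. (k \<theta> ^ 3 / 6) *\<^sub>R D 3 0)"
proof -
  obtain C \<rho> where \<rho>: "\<rho> > 0" "\<And>t. \<bar>t\<bar> \<le> \<rho> \<Longrightarrow> t \<in> U"
    and C: "\<And>t. \<bar>t\<bar> \<le> \<rho> \<Longrightarrow>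
      norm (\<gamma> t - (\<gamma> 0 + t *\<^sub>R D 1 0 + (t\<^sup>2 / 2) *\<^sub>R D 2 0 + (t ^ 3 / 6) *\<^sub>R D 3 0)) \<le> C * \<bar>t\<bar> ^ 4"
    using curve_taylor[OF assms(1,2,4)] unfolding D_def by metis
  have kh: "unif_bigo K 1 (\<lambda>h \<theta>. k \<theta> * h)"
    using unif_bigo_power_scaleR[OF k, of 1 1] by (simp add: mult.commute)
  have small: "\<forall>\<^sub>F h in at_right 0. \<forall>\<theta>\<in>K. norm (k \<theta> * h) \<le> \<rho>"
    using unif_bigo_small[OF kh _ \<rho>(1)] by simp
  have "unif_bigo K 0 (\<lambda>h \<theta>. k \<theta> * (k \<theta> * (k \<theta> * k \<theta>)))"
    by (intro unif_bigo_0_intros k)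
  then have "unif_bigo K 4 (\<lambda>h \<theta>. h ^ 4 *\<^sub>R (k \<theta> * (k \<theta> * (k \<theta> * k \<theta>))))"
    by (rule unif_bigo_power_scaleR) simp
  moreover have "\<forall>\<^sub>F h in at_right 0. \<forall>\<theta>\<in>K.
      norm (\<gamma> (k \<theta> * h) - (\<gamma> 0 + h *\<^sub>R (k \<theta> *\<^sub>R D 1 0) + h\<^sup>2 *\<^sub>R (((k \<theta>)\<^sup>2 / 2) *\<^sub>R D 2 0) + h ^ 3 *\<^sub>R ((k \<theta> ^ 3 / 6) *\<^sub>R D 3 0)))
      \<le> \<bar>C\<bar> * norm (h ^ 4 *\<^sub>R (k \<theta> * (k \<theta> * (k \<theta> * k \<theta>))))"
    using small
  proof eventually_elim
    case (elim h)
    show ?case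
    proof
      fix \<theta> assume "\<theta> \<in> K"
      then have "norm (\<gamma> (k \<theta> * h) - (\<gamma> 0 + (k \<theta> * h) *\<^sub>R D 1 0 + ((k \<theta> * h)\<^sup>2 / 2) *\<^sub>R D 2 0 + ((k \<theta> * h) ^ 3 / 6) *\<^sub>R D 3 0))
          \<le> C * \<bar>k \<theta> * h\<bar> ^ 4"
        using elim by (intro C) simp
      also have "\<dots> \<le> \<bar>C\<bar> * \<bar>k \<theta> * h\<bar> ^ 4" by (intro mult_right_mono) auto
      also have "\<bar>k \<theta> * h\<bar> ^ 4 = norm (h ^ 4 *\<^sub>R (k \<theta> * (k \<theta> * (k \<theta> * k \<theta>))))"
        by (simp add: abs_mult power_mult_distrib power_abs) (simp add: eval_nat_numeral)
      finally show "norm (\<gamma> (k \<theta> * h) - (\<gamma> 0 + h *\<^sub>R (k \<theta> *\<^sub>R D 1 0) + h\<^sup>2 *\<^sub>R (((k \<theta>)\<^sup>2 / 2) *\<^sub>R D 2 0) + h ^ 3 *\<^sub>R ((k \<theta> ^ 3 / 6) *\<^sub>R D 3 0)))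
          \<le> \<bar>C\<bar> * norm (h ^ 4 *\<^sub>R (k \<theta> * (k \<theta> * (k \<theta> * k \<theta>))))"
        by (simp add: power_mult_distrib mult_ac)
    qed
  qed
  ultimately have "unif_bigo K 4 (\<lambda>h \<theta>. \<gamma> (k \<theta> * h) - (\<gamma> 0 + h *\<^sub>R (k \<theta> *\<^sub>R D 1 0) + h\<^sup>2 *\<^sub>R (((k \<theta>)\<^sup>2 / 2) *\<^sub>R D 2 0) + h ^ 3 *\<^sub>R ((k \<theta> ^ 3 / 6) *\<^sub>R D 3 0)))"
    by (rule unif_bigo_bounded_by) simp
  moreover have "\<forall>\<^sub>F h in at_right 0. \<forall>\<theta>\<in>K. norm (\<gamma> (k \<theta> * h)) = 1"
    using small by eventually_elim (use \<rho>(2) assms(3) in force)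
  moreover have "unif_bigo K 0 (\<lambda>h \<theta>. k \<theta> *\<^sub>R D 1 0)" "unif_bigo K 0 (\<lambda>h \<theta>. ((k \<theta>)\<^sup>2 / 2) *\<^sub>R D 2 0)"
     "unif_bigo K 0 (\<lambda>h \<theta>. (k \<theta> ^ 3 / 6) *\<^sub>R D 3 0)"
    unfolding power2_eq_square power3_eq_cube divide_inverse by (intro unif_bigo_0_intros k)+
  ultimately show ?thesis unfolding sphere_jet_def by simp
qed

text \<open>Allows a coefficient at the moving point \<theta> h to replace its value at 0 with error
  O(h), which a factor h^3 turns into O(h^4).\<close>

lemma has_vector_derivative_unif_bigo:
  fixes f :: "real \<Rightarrow> 'a::real_normed_vector"
  assumes "(f has_vector_derivative f') (at 0)" and K: "bounded K"
  shows "unif_bigo K 1 (\<lambda>h \<theta>. f (\<theta> * h) - f 0)"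
proof -
  have "(f has_derivative (\<lambda>x. x *\<^sub>R f')) (at 0)"
    using assms(1) by (simp add: has_vector_derivative_def)
  \<comment> \<open>The definition of the derivative with epsilon = 1, which yields the Lipschitz
    constant 1 + |f'|.\<close>
  then obtain d where d: "d > 0" "\<And>y. \<bar>y\<bar> < d \<Longrightarrow> norm (f y - f 0 - y *\<^sub>R f') \<le> \<bar>y\<bar>"
    unfolding has_derivative_at_alt by (metis diff_zero mult_1 real_norm_def zero_less_one)
  have \<theta>h: "unif_bigo K 1 (\<lambda>h \<theta>. \<theta> * h)"
    using unif_bigo_power_scaleR[OF unif_bigo_id[OF K], of 1 1] by (simp add: mult.commute)
  have "\<forall>\<^sub>F h in at_right 0. \<forall>\<theta>\<in>K. norm (f (\<theta> * h) - f 0) \<le> (1 + norm f') * norm (\<theta> * h)"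
    using unif_bigo_small[OF \<theta>h zero_less_one half_gt_zero[OF d(1)]]
  proof eventually_elim
    case (elim h)
    show ?case
    proof
      fix \<theta> assume "\<theta> \<in> K"
      then have "\<bar>\<theta> * h\<bar> < d" using elim d(1) by force
      from d(2)[OF this] have "norm (f (\<theta> * h) - f 0) \<le> \<bar>\<theta> * h\<bar> + norm ((\<theta> * h) *\<^sub>R f')"
        by (smt (verit) norm_triangle_ineq2)
      then show "norm (f (\<theta> * h) - f 0) \<le> (1 + norm f') * norm (\<theta> * h)"
        by (simp add: algebra_simps)
    qed
  qed
  then show ?thesis by (rule unif_bigo_bounded_by[OF \<theta>h]) simp
qed

section \<open>From jets to the logarithm and the distance\<close>

theorem proposition1:
  fixes K U :: "real set" and \<gamma> :: "real \<Rightarrow> real ^ 3"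
    and c :: "real \<Rightarrow> real ^ 3" and r :: "real \<Rightarrow> real"
  assumes "is_interval K" and "bounded K"
    and "open U" and "0 \<in> U" and "\<gamma> ` U \<subseteq> S2" and "Ck_on 4 \<gamma> U"
    and "r \<in> O[at_right 0](\<lambda>h. h)"
    and "\<forall>\<^sub>F h in at_right 0.
           c h \<in> S2 \<and> geodesically_convex (ball_S2 (c h) (r h)) \<and>
           (\<forall>\<theta>\<in>K. sider2_points h (\<gamma> 0) (\<gamma> h) (\<gamma> (2 * h)) (\<theta> * h) \<subseteq> ball_S2 (c h) (r h))"
  shows "(\<exists>C. \<forall>\<^sub>F h in at_right 0. \<forall>\<theta>\<in>K.
            norm (Log_S2 (\<gamma> (\<theta> * h)) (sider2 h (\<gamma> 0) (\<gamma> h) (\<gamma> (2 * h)) (\<theta> * h))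
                  - (- (h ^ 3 / 6 * \<theta> * (\<theta> - 1) * (\<theta> - 2)) *\<^sub>R
                       nth_vector_derivative 3 (normal_curve \<gamma> (\<theta> * h)) 0))
            \<le> C * h ^ 4) \<and>
         (\<exists>C. \<forall>\<^sub>F h in at_right 0. \<forall>\<theta>\<in>K.
            dist_S2 (\<gamma> (\<theta> * h)) (sider2 h (\<gamma> 0) (\<gamma> h) (\<gamma> (2 * h)) (\<theta> * h))
            \<le> C * h ^ 3)"
proof -
  note curve = assms(3-6) and K = assms(2)
  define D where "D = (\<lambda>k. nth_vector_derivative k \<gamma>)"
  \<comment> \<open>The explicit form is the one that the jets produce and that is visibly
    differentiable; \<open>B'\<close> below is the derivative in the claim. The two agree on
    \<open>U\<close>.\<close>
  define B where "B = (\<lambda>s. (D 1 s \<bullet> D 1 s) *\<^sub>R D 1 s + D 3 s + (3 * (D 1 s \<bullet> D 2 s)) *\<^sub>R \<gamma> s)"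
  define P where "P = (\<lambda>h \<theta>. sider2 h (\<gamma> 0) (\<gamma> h) (\<gamma> (2 * h)) (\<theta> * h))"
  define \<omega> where "\<omega> = (\<lambda>\<theta>::real. \<theta> * (\<theta> - 1) * (\<theta> - 2) / 6)"
  define B' where "B' = (\<lambda>s. nth_vector_derivative 3 (normal_curve \<gamma> s) 0)"
  have \<theta>: "unif_bigo K 0 (\<lambda>h \<theta>. \<theta>)" using K by (rule unif_bigo_id)
  have \<omega>: "unif_bigo K 0 (\<lambda>h. \<omega>)"
    unfolding \<omega>_def divide_inverse by (intro unif_bigo_0_intros \<theta>)
  have \<gamma>jet: "sphere_jet K (\<gamma> 0) (\<lambda>h \<theta>. \<gamma> (\<theta> * h)) (\<lambda>\<theta>. \<theta> *\<^sub>R D 1 0)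
     (\<lambda>\<theta>. (\<theta>\<^sup>2 / 2) *\<^sub>R D 2 0) (\<lambda>\<theta>. (\<theta> ^ 3 / 6) *\<^sub>R D 3 0)"
    unfolding D_def by (rule sphere_jet_curve[OF curve \<theta>])
  have node: "sphere_jet K (\<gamma> 0) (\<lambda>h \<theta>. \<gamma> (k * h)) (\<lambda>\<theta>. k *\<^sub>R D 1 0)
     (\<lambda>\<theta>. (k\<^sup>2 / 2) *\<^sub>R D 2 0) (\<lambda>\<theta>. (k ^ 3 / 6) *\<^sub>R D 3 0)" for k
    unfolding D_def by (rule sphere_jet_curve[OF curve unif_bigo_const])
  have orth: "\<gamma> 0 \<bullet> D 1 0 = 0"
    using spherical_curve_derivatives(1)[OF assms(3,5,6,4)] by (simp add: D_def)
  have Pjet: "sphere_jet K (\<gamma> 0)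
     (\<lambda>h \<theta>. slerp (slerp (\<gamma> 0) (sider2_da (\<gamma> h) (\<gamma> (2 * h))) (\<theta> / 2))
                  (slerp (sider2_db (\<gamma> 0) (\<gamma> h)) (\<gamma> (2 * h)) (\<theta> / 2)) (\<theta> / 2))
     (\<lambda>\<theta>. \<theta> *\<^sub>R D 1 0) (\<lambda>\<theta>. (\<theta>\<^sup>2 / 2) *\<^sub>R D 2 0)
     (\<lambda>\<theta>. (\<theta> ^ 3 / 6) *\<^sub>R D 3 0 - \<omega> \<theta> *\<^sub>R B 0)"
    unfolding \<omega>_def B_def
    by (rule sphere_jet_sider2[where ?p0.0 = "\<lambda>h \<theta>. \<gamma> 0" and ?p1.0 = "\<lambda>h \<theta>. \<gamma> h"
          and ?p2.0 = "\<lambda>h \<theta>. \<gamma> (2 * h)", OF K orth])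
       (use node[of 0] node[of 1] node[of 2] in \<open>simp_all add: power2_eq_square power3_eq_cube\<close>)
  have P_eq: "P h \<theta> = slerp (slerp (\<gamma> 0) (sider2_da (\<gamma> h) (\<gamma> (2 * h))) (\<theta> / 2))
                  (slerp (sider2_db (\<gamma> 0) (\<gamma> h)) (\<gamma> (2 * h)) (\<theta> / 2)) (\<theta> / 2)" if "h > 0" for h \<theta>
    using that by (simp add: P_def sider2_def sider2_left_def sider2_right_def)
  have P4: "unif_bigo K 4 (\<lambda>h \<theta>. P h \<theta> - (\<gamma> 0 + h *\<^sub>R (\<theta> *\<^sub>R D 1 0) + h ^ 2 *\<^sub>R ((\<theta>\<^sup>2 / 2) *\<^sub>R D 2 0)
      + h ^ 3 *\<^sub>R ((\<theta> ^ 3 / 6) *\<^sub>R D 3 0 - \<omega> \<theta> *\<^sub>R B 0)))"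
    by (rule unif_bigo_cong_gt_0) (use Pjet in \<open>auto simp: sphere_jet_def P_eq\<close>)
  have \<gamma>4: "unif_bigo K 4 (\<lambda>h \<theta>. \<gamma> (\<theta> * h) - (\<gamma> 0 + h *\<^sub>R (\<theta> *\<^sub>R D 1 0) + h ^ 2 *\<^sub>R ((\<theta>\<^sup>2 / 2) *\<^sub>R D 2 0)
      + h ^ 3 *\<^sub>R ((\<theta> ^ 3 / 6) *\<^sub>R D 3 0)))"
    using \<gamma>jet by (simp add: sphere_jet_def)
  have units: "\<forall>\<^sub>F h in at_right 0. \<forall>\<theta>\<in>K. norm (P h \<theta>) = 1" "\<forall>\<^sub>F h in at_right 0. \<forall>\<theta>\<in>K. norm (\<gamma> (\<theta> * h)) = 1"
  proof -
    have "\<forall>\<^sub>F h in at_right 0. \<forall>\<theta>\<in>K. norm (slerp (slerp (\<gamma> 0) (sider2_da (\<gamma> h) (\<gamma> (2 * h))) (\<theta> / 2))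
                  (slerp (sider2_db (\<gamma> 0) (\<gamma> h)) (\<gamma> (2 * h)) (\<theta> / 2)) (\<theta> / 2)) = 1"
      using Pjet by (simp add: sphere_jet_def)
    then show "\<forall>\<^sub>F h in at_right 0. \<forall>\<theta>\<in>K. norm (P h \<theta>) = 1"
      using eventually_at_right_0_less_1 by eventually_elim (simp add: P_eq)
    show "\<forall>\<^sub>F h in at_right 0. \<forall>\<theta>\<in>K. norm (\<gamma> (\<theta> * h)) = 1"
      using \<gamma>jet by (simp add: sphere_jet_def)
  qed
  \<comment> \<open>\<open>B\<close> involves three derivatives of the curve, so the fourth one
    makes it differentiable at 0.\<close>
  have B1: "unif_bigo K 1 (\<lambda>h \<theta>. B (\<theta> * h) - B 0)"
  proof -
    have D: "(D k has_vector_derivative D (Suc k) 0) (at 0)" if "k < 4" for k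
      unfolding D_def using Ck_on_has_vector_derivative[OF assms(6) that assms(4)] .
    have D': "D k differentiable at 0" if "k < 4" for k
      using D[OF that] by (rule differentiableI_vector)
    have "\<gamma> = D 0" by (simp add: D_def)
    then have "B differentiable at 0"
      unfolding B_def by (auto intro!: derivative_intros differentiable_inner D')
    then have "(B has_vector_derivative vector_derivative B (at 0)) (at 0)"
      by (simp add: vector_derivative_works)
    then show ?thesis using K by (rule has_vector_derivative_unif_bigo)
  qed
  have B'1: "unif_bigo K 1 (\<lambda>h \<theta>. B' (\<theta> * h) - B 0)"
  proof (rule unif_bigo_cong[OF B1])
    obtain \<rho> where \<rho>: "\<rho> > 0" "cball 0 \<rho> \<subseteq> U" using assms(3,4) open_contains_cball by blast
    have \<theta>h: "unif_bigo K 1 (\<lambda>h \<theta>. \<theta> * h)"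
      using unif_bigo_power_scaleR[OF \<theta>, of 1 1] by (simp add: mult.commute)
    have "\<forall>\<^sub>F h in at_right 0. \<forall>\<theta>\<in>K. norm (\<theta> * h) \<le> \<rho>"
      using unif_bigo_small[OF \<theta>h _ \<rho>(1)] by simp
    then show "\<forall>\<^sub>F h in at_right 0. \<forall>\<theta>\<in>K. B' (\<theta> * h) - B 0 = B (\<theta> * h) - B 0"
    proof eventually_elim
      case (elim h)
      then have "\<theta> * h \<in> U" if "\<theta> \<in> K" for \<theta> using that \<rho>(2) by (auto simp: subset_iff)
      then show ?case
        using normal_curve_third_derivative[OF assms(3,5,6)] by (simp add: B_def B'_def D_def)
    qed
  qed
  \<comment> \<open>The two jets agree through order 2; their cubic difference carries
    \<open>B 0\<close>, which is exchanged for the value at the moving point.\<close>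
  have E: "unif_bigo K 4 (\<lambda>h \<theta>. P h \<theta> - \<gamma> (\<theta> * h) + (h ^ 3 * \<omega> \<theta>) *\<^sub>R B' (\<theta> * h))"
  proof -
    have "unif_bigo K 3 (\<lambda>h \<theta>. h ^ 3 * \<omega> \<theta>)"
      using unif_bigo_power_scaleR[OF \<omega>, of 3 3] by simp
    then have "unif_bigo K 4 (\<lambda>h \<theta>. (h ^ 3 * \<omega> \<theta>) *\<^sub>R (B' (\<theta> * h) - B 0))"
      by (rule unif_bigo_scaleR[OF _ B'1]) simp
    from unif_bigo_add[OF unif_bigo_diff[OF P4 \<gamma>4] this] show ?thesis
      by (rule unif_bigo_cong_gt_0) (simp add: algebra_simps)
  qed
  have E3: "unif_bigo K 3 (\<lambda>h \<theta>. P h \<theta> - \<gamma> (\<theta> * h))"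
  proof -
    have "unif_bigo K 3 (\<lambda>h \<theta>. h ^ 3 *\<^sub>R (\<omega> \<theta> *\<^sub>R B 0))"
      by (intro unif_bigo_power_scaleR unif_bigo_0_intros \<omega>) simp
    from unif_bigo_diff[OF unif_bigo_mono[OF unif_bigo_diff[OF P4 \<gamma>4]] this] show ?thesis
      by (rule unif_bigo_cong_gt_0) (simp_all add: algebra_simps)
  qed
  note small = unif_bigo_small[OF E3, of "1/2", simplified]
  \<comment> \<open>The logarithm differs from the chord by at most twice the squared chord, itself
    O(h^6), so the estimate for the chord carries over.\<close>
  have "unif_bigo K 4 (\<lambda>h \<theta>. Log_S2 (\<gamma> (\<theta> * h)) (P h \<theta>) - (P h \<theta> - \<gamma> (\<theta> * h)))"
  proof (rule unif_bigo_bounded_by)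
    show "unif_bigo K 4 (\<lambda>h \<theta>. (P h \<theta> - \<gamma> (\<theta> * h)) \<bullet> (P h \<theta> - \<gamma> (\<theta> * h)))"
      by (rule unif_bigo_inner[OF E3 E3]) simp
    show "\<forall>\<^sub>F h in at_right 0. \<forall>\<theta>\<in>K. norm (Log_S2 (\<gamma> (\<theta> * h)) (P h \<theta>) - (P h \<theta> - \<gamma> (\<theta> * h)))
       \<le> 2 * norm ((P h \<theta> - \<gamma> (\<theta> * h)) \<bullet> (P h \<theta> - \<gamma> (\<theta> * h)))"
      using units small
    proof eventually_elim
      case (elim h)
      then show ?case using Log_S2_close by (simp flip: power2_norm_eq_inner)
    qed
  qed simp
  from unif_bigo_add[OF this E]
  have "unif_bigo K 4 (\<lambda>h \<theta>. Log_S2 (\<gamma> (\<theta> * h)) (P h \<theta>)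
      - (- (h ^ 3 / 6 * \<theta> * (\<theta> - 1) * (\<theta> - 2)) *\<^sub>R B' (\<theta> * h)))"
    by (rule unif_bigo_cong_gt_0) (simp add: \<omega>_def mult_ac)
  moreover have "unif_bigo K 3 (\<lambda>h \<theta>. dist_S2 (\<gamma> (\<theta> * h)) (P h \<theta>))"
  proof (rule unif_bigo_bounded_by[OF E3])
    show "\<forall>\<^sub>F h in at_right 0. \<forall>\<theta>\<in>K. norm (dist_S2 (\<gamma> (\<theta> * h)) (P h \<theta>)) \<le> 2 * norm (P h \<theta> - \<gamma> (\<theta> * h))"
      using units small
    proof eventually_elim
      case (elim h)
      show ?case
      proof
        fix \<theta> assume "\<theta> \<in> K"
        with elim have u: "norm (\<gamma> (\<theta> * h)) = 1" "norm (P h \<theta>) = 1" "norm (P h \<theta> - \<gamma> (\<theta> * h)) \<le> 1 / 2" by auto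
        then have "0 \<le> dist_S2 (\<gamma> (\<theta> * h)) (P h \<theta>)"
          using angle_of_close_unit_vectors(2) by (simp add: dist_S2_def)
        then show "norm (dist_S2 (\<gamma> (\<theta> * h)) (P h \<theta>)) \<le> 2 * norm (P h \<theta> - \<gamma> (\<theta> * h))"
          using dist_S2_le[OF u] by simp
      qed
    qed
  qed simp
  ultimately show ?thesis
    unfolding unif_bigo_def P_def B'_def real_norm_def
    by (blast intro: eventually_mono order_trans[OF abs_ge_self])
qed

end
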